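(* Let $\epsilon>0$. Consider the separable convex problem described in the context, and suppose that a dual maximizer $\lambda^*\in\mathbb{R}^m_+$ exists and that strong duality holds. Consider the two-stage algorithm described in the context with $T=K$ (and with $\lambda_0=0_m$, constant stepsize $\alpha_t=\alpha=\frac{\Lambda}{\tilde G\sqrt T}$ for some $\Lambda>0$, and Frank-Wolfe stepsizes $\rho_k=\frac{2N}{k+2N}$). In order for the output $\hat x^K=(\hat x_1^K,\dots,\hat x_N^K)$ to be an $\epsilon$-accurate primal solution in expectation, i.e. $\hat x_i^K\in X_i$ for all $i$ and $$\mathbb{E}\Big[\frac1N\sum_{i=1}^N h_i(\hat x_i^K)\Big]\le d^*+\epsilon,\qquad \mathbb{E}\Big\|\frac1N\sum_{i=1}^N A_i\hat x_i^K-b\Big\|_+\le\epsilon,$$ the total number of oracle calls is bounded above by $$O\Big(\frac{1}{\epsilon^2}+\frac{N}{\epsilon^{2/3}}\Big).$$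
   Context: Problem. For $i=1,\dots,N$, $h_i:\mathbb{R}^{d_i}\to\mathbb{R}\cup\{+\infty\}$ is proper, convex, lower semicontinuous with convex compact domain $X_i=\mathrm{dom}(h_i)$; $A_i\in\mathbb{R}^{m\times d_i}$, $b\in\mathbb{R}^m$. The primal problem is to minimize $\frac1N\sum_i h_i(x_i)$ subject to $\frac1N\sum_i A_ix_i\le b$ (componentwise), $x_i\in X_i$. The dual function is $d(\lambda)=-\lambda^\top b+\frac1N\sum_{i=1}^N\inf_{x_i\in X_i}\{h_i(x_i)+\lambda^\top A_ix_i\}$, maximized over $\lambda\in\mathbb{R}^m_+$. The duality assumption is: there is $\lambda^*\in\arg\max_{\lambda\in\mathbb{R}^m_+}d(\lambda)$, and $d^*:=d(\lambda^* )$ equals the optimal value of the primal problem (strong duality). Notation. $\|\cdot\|$ is the Euclidean norm, $\|x\|_+=\sqrt{\sum_j\max(x_j,0)^2}$, $\Pi_+(x)_j=\max(x_j,0)$. $\tilde G=\sup_{i,\,x_i\in X_i}\|A_ix_i-b\|$, $H=\sup_{i,\,x_i\in X_i}|h_i(x_i)|$. $C_i=\{(h_i(x_i),A_ix_i):x_i\in X_i\}\subset\mathbb{R}^{1+m}$ and $D^2=\frac1N\sum_i\mathrm{diam}(\mathrm{conv}(C_i))^2$. The $O(\cdot)$ notation keeps only $N$ and $\epsilon$ and hides all other quantities ($\tilde G,H,D,\Lambda,\|\lambda^*\|$). Oracle. An oracle call for index $i$ with $\gamma\ge0$, $\lambda\in\mathbb{R}^m$ returns a point $x_i^*((\gamma,\lambda))\in\arg\min_{x_i\in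 X_i}\{\gamma h_i(x_i)+\lambda^\top A_ix_i\}$; write $x_i^*(\lambda)=x_i^*((1,\lambda))$. Stage 1 (stochastic dual subgradient, $T$ iterations). Start from $\lambda_0$. For $t=0,\dots,T-2$: sample $i_t$ uniformly at random in $\{1,\dots,N\}$, set $g_t=A_{i_t}x^*_{i_t}(\lambda_t)-b$ and $\lambda_{t+1}=\Pi_+(\lambda_t+\alpha_tg_t)$. Let $I_i$ be the number of $t\in\{0,\dots,T-2\}$ with $i_t=i$. Last step ($t=T-1$): compute $x_i^*(\lambda_{T-1})$ for all $i$, set $g_{T-1}=\frac1N\sum_iA_ix_i^*(\lambda_{T-1})-b$, $\lambda_T=\Pi_+(\lambda_{T-1}+\alpha_{T-1}g_{T-1})$. Output $\bar\lambda_T=\frac1T\sum_{t=0}^{T-1}\lambda_t$ and $\bar x_{i,T}=\frac1{I_i+1}\big(x_i^*(\lambda_{T-1})+\sum_{t\le T-2,\,i_t=i}x_i^*(\lambda_t)\big)$. Stage 2 (block-coordinate Frank-Wolfe, $K$ iterations). Set $\hat x_i^0=x_i^0=\bar x_{i,T}$, $\beta_i^0=\frac1Nh_i(x_i^0)$, $z_i^0=\frac1NA_ix_i^0$. For $k=0,\dots,K-1$: with $\beta^k=\sum_i\beta_i^k$, $z^k=\sum_iz_i^k$, set $\gamma^k=\max(\beta^k-d(\bar\lambda_T),0)$, $g^k=\Pi_+(z^k-b)$; sample $i_k$ uniformly at random in $\{1,\dots,N\}$; compute $x_{i_k}^{k+1}=x^*_{i_k}((\gamma^k,g^k))$; for $i=i_k$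 set $(\beta_i^{k+1},z_i^{k+1})=(1-\rho_k)(\beta_i^k,z_i^k)+\frac{\rho_k}{N}(h_i(x_i^{k+1}),A_ix_i^{k+1})$ and $\hat x_i^{k+1}=(1-\rho_k)\hat x_i^k+\rho_kx_i^{k+1}$; all other blocks are unchanged. Output $\hat x^K$. Counting of oracle calls: one call per iteration of stage 1, except its last one which uses $N$ calls, and one call per iteration of stage 2. $\mathbb{E}$ is the expectation over the randomness of both stages. *)

theory Defs
  imports "HOL-Analysis.Analysis" "HOL-Probability.Product_PMF"
begin

text \<open>
  The dimensions \<open>m\<close> and \<open>d\<^sub>1, \<dots>, d\<^sub>N\<close> vary inside the statement (the hidden constant may not
  depend on them), so they cannot be types.  A vector of \<open>\<real>\<^sup>n\<close> is a point of the library's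
  \<open>Euclidean_space n\<close>, i.e. a function \<open>nat \<Rightarrow> real\<close> that vanishes from index \<open>n\<close> on.
  Blocks and coordinates are numbered from 0.
\<close>

type_synonym vect = "nat \<Rightarrow> real"

abbreviation rvec :: "nat \<Rightarrow> vect set" where
  "rvec n \<equiv> topspace (Euclidean_space n)"

definition dot :: "nat \<Rightarrow> vect \<Rightarrow> vect \<Rightarrow> real" where
  "dot n x y = (\<Sum>j<n. x j * y j)"

definition vnorm :: "nat \<Rightarrow> vect \<Rightarrow> real" where
  "vnorm n x = L2_set x {..<n}"

definition pos_part :: "vect \<Rightarrow> vect" where
  "pos_part x = (\<lambda>j. max (x j) 0)"

definition vnorm_plus :: "nat \<Rightarrow> vect \<Rightarrow> real" where
  "vnorm_plus n x = sqrt (\<Sum>j<n. (max (x j) 0)\<^sup>2)"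

definition matvec :: "nat \<Rightarrow> nat \<Rightarrow> (nat \<Rightarrow> nat \<Rightarrow> real) \<Rightarrow> vect \<Rightarrow> vect" where
  "matvec m d M x = (\<lambda>j. if j < m then (\<Sum>k<d. M j k * x k) else 0)"

definition seg :: "real \<Rightarrow> vect \<Rightarrow> vect \<Rightarrow> vect" where
  "seg t x y = (\<lambda>j. (1 - t) * x j + t * y j)"

text \<open>
  The type \<open>nat \<Rightarrow> real\<close> is not an instance of \<open>real_vector\<close>, and its metric is not the Euclidean
  one, so \<open>convex\<close> and \<open>diameter\<close> of the library do not apply.
\<close>

definition convex_set :: "vect set \<Rightarrow> bool" where
  "convex_set S \<longleftrightarrow> (\<forall>x\<in>S. \<forall>y\<in>S. \<forall>t\<in>{0..1}. seg t x y \<in> S)"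

definition diam :: "nat \<Rightarrow> vect set \<Rightarrow> real" where
  "diam n S = (SUP (x, y) \<in> S \<times> S. vnorm n (\<lambda>j. x j - y j))"

definition eff_dom :: "nat \<Rightarrow> (vect \<Rightarrow> ereal) \<Rightarrow> vect set" where
  "eff_dom d h = {x \<in> rvec d. h x < \<infinity>}"

definition proper_fun :: "nat \<Rightarrow> (vect \<Rightarrow> ereal) \<Rightarrow> bool" where
  "proper_fun d h \<longleftrightarrow> (\<forall>x \<in> rvec d. h x \<noteq> -\<infinity>) \<and> eff_dom d h \<noteq> {}"

definition convex_fun :: "nat \<Rightarrow> (vect \<Rightarrow> ereal) \<Rightarrow> bool" where
  "convex_fun d h \<longleftrightarrow> (\<forall>x \<in> rvec d. \<forall>y \<in> rvec d. \<forall>t \<in> {0<..<1}.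
      h (seg t x y) \<le> ereal (1 - t) * h x + ereal t * h y)"

definition lsc_fun :: "nat \<Rightarrow> (vect \<Rightarrow> ereal) \<Rightarrow> bool" where
  "lsc_fun d h \<longleftrightarrow> (\<forall>x \<in> rvec d. h x \<le> Liminf (atin (Euclidean_space d) x) h)"


record sep_problem =
  nblocks :: nat                            \<comment> \<open>\<open>N\<close>\<close>
  ncons :: nat                              \<comment> \<open>\<open>m\<close>\<close>
  bdim :: "nat \<Rightarrow> nat"                      \<comment> \<open>\<open>d\<^sub>i\<close>\<close>
  obj :: "nat \<Rightarrow> vect \<Rightarrow> ereal"             \<comment> \<open>\<open>h\<^sub>i\<close>\<close>
  cmat :: "nat \<Rightarrow> nat \<Rightarrow> nat \<Rightarrow> real"       \<comment> \<open>\<open>A\<^sub>i\<close> (row, column)\<close>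
  rhs :: vect                               \<comment> \<open>\<open>b\<close>\<close>

definition Xset :: "sep_problem \<Rightarrow> nat \<Rightarrow> vect set" where
  "Xset P i = eff_dom (bdim P i) (obj P i)"

definition sep_convex_problem :: "sep_problem \<Rightarrow> bool" where
  "sep_convex_problem P \<longleftrightarrow>
     nblocks P \<ge> 1 \<and> rhs P \<in> rvec (ncons P) \<and>
     (\<forall>i < nblocks P.
        proper_fun (bdim P i) (obj P i) \<and>
        convex_fun (bdim P i) (obj P i) \<and>
        lsc_fun (bdim P i) (obj P i) \<and>
        convex_set (Xset P i) \<and>
        compactin (Euclidean_space (bdim P i)) (Xset P i))"

text \<open>The real value of \<open>h\<^sub>i\<close>; it is only used on \<open>X\<^sub>i\<close>, where \<open>h\<^sub>i\<close> is finite.\<close>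

definition hval :: "sep_problem \<Rightarrow> nat \<Rightarrow> vect \<Rightarrow> real" where
  "hval P i x = real_of_ereal (obj P i x)"

definition Ax :: "sep_problem \<Rightarrow> nat \<Rightarrow> vect \<Rightarrow> vect" where
  "Ax P i x = matvec (ncons P) (bdim P i) (cmat P i) x"

definition avg_obj :: "sep_problem \<Rightarrow> (nat \<Rightarrow> vect) \<Rightarrow> real" where
  "avg_obj P x = (1 / real (nblocks P)) * (\<Sum>i<nblocks P. hval P i (x i))"

definition avg_residual :: "sep_problem \<Rightarrow> (nat \<Rightarrow> vect) \<Rightarrow> vect" where
  "avg_residual P x =
     (\<lambda>j. (1 / real (nblocks P)) * (\<Sum>i<nblocks P. Ax P i (x i) j) - rhs P j)"

definition feasible_set :: "sep_problem \<Rightarrow> (nat \<Rightarrow> vect) set" where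
  "feasible_set P = {x. (\<forall>i<nblocks P. x i \<in> Xset P i) \<and>
     (\<forall>j<ncons P. (1 / real (nblocks P)) * (\<Sum>i<nblocks P. Ax P i (x i) j) \<le> rhs P j)}"

text \<open>Extended-real, so that an infeasible problem has the value \<open>\<infinity>\<close>.\<close>

definition primal_value :: "sep_problem \<Rightarrow> ereal" where
  "primal_value P = (INF x \<in> feasible_set P. ereal (avg_obj P x))"

text \<open>
  The real infima below range over nonempty sets and are attained, since each \<open>h\<^sub>i\<close> is lower
  semicontinuous with compact domain.
\<close>

definition dual_fun :: "sep_problem \<Rightarrow> vect \<Rightarrow> real" where
  "dual_fun P l = - dot (ncons P) l (rhs P) + (1 / real (nblocks P)) *
     (\<Sum>i<nblocks P. INF x \<in> Xset P i. hval P i x + dot (ncons P) l (Ax P i x))"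

definition nonneg_vecs :: "nat \<Rightarrow> vect set" where
  "nonneg_vecs m = {l \<in> rvec m. \<forall>j<m. 0 \<le> l j}"

definition dual_maximizer :: "sep_problem \<Rightarrow> vect \<Rightarrow> bool" where
  "dual_maximizer P l \<longleftrightarrow> is_arg_max (dual_fun P) (\<lambda>v. v \<in> nonneg_vecs (ncons P)) l"

definition Gtilde :: "sep_problem \<Rightarrow> real" where
  "Gtilde P = (SUP (i, x) \<in> (SIGMA i : {..<nblocks P}. Xset P i).
     vnorm (ncons P) (\<lambda>j. Ax P i x j - rhs P j))"

definition Hvals :: "sep_problem \<Rightarrow> real set" where
  "Hvals P = (\<lambda>(i, x). \<bar>hval P i x\<bar>) ` (SIGMA i : {..<nblocks P}. Xset P i)"

definition Hsup :: "sep_problem \<Rightarrow> real" where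
  "Hsup P = Sup (Hvals P)"

text \<open>\<open>C\<^sub>i\<close> lies in \<open>\<real>\<^sup>1\<^sup>+\<^sup>m\<close>; coordinate 0 holds the value of \<open>h\<^sub>i\<close>.\<close>

definition Cset :: "sep_problem \<Rightarrow> nat \<Rightarrow> vect set" where
  "Cset P i = (\<lambda>x. case_nat (hval P i x) (Ax P i x)) ` Xset P i"

definition Dconst :: "sep_problem \<Rightarrow> real" where
  "Dconst P = sqrt ((1 / real (nblocks P)) *
     (\<Sum>i<nblocks P. (diam (Suc (ncons P)) (convex_set hull Cset P i))\<^sup>2))"


text \<open>\<open>orc i \<gamma> \<lambda>\<close> is \<open>x\<^sub>i\<^sup>*((\<gamma>, \<lambda>))\<close>: an arbitrary but fixed selection of minimizers.\<close>

type_synonym oracle_fun = "nat \<Rightarrow> real \<Rightarrow> vect \<Rightarrow> vect"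

definition is_oracle :: "sep_problem \<Rightarrow> oracle_fun \<Rightarrow> bool" where
  "is_oracle P orc \<longleftrightarrow> (\<forall>i<nblocks P. \<forall>\<gamma>\<ge>0. \<forall>l \<in> rvec (ncons P).
     is_arg_min (\<lambda>x. \<gamma> * hval P i x + dot (ncons P) l (Ax P i x))
       (\<lambda>x. x \<in> Xset P i) (orc i \<gamma> l))"


text \<open>
  Both stages are deterministic functions of the sampled indices: \<open>s t\<close> is \<open>i\<^sub>t\<close> of stage 1
  (\<open>t < T - 1\<close>) and \<open>r k\<close> is \<open>i\<^sub>k\<close> of stage 2 (\<open>k < K\<close>).
\<close>

definition dual_dir ::
  "sep_problem \<Rightarrow> oracle_fun \<Rightarrow> nat \<Rightarrow> (nat \<Rightarrow> nat) \<Rightarrow> nat \<Rightarrow> vect \<Rightarrow> vect" where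
  "dual_dir P orc T s t l =
     (if Suc t = T then avg_residual P (\<lambda>i. orc i 1 l)
      else (\<lambda>j. Ax P (s t) (orc (s t) 1 l) j - rhs P j))"

primrec dual_iter ::
  "sep_problem \<Rightarrow> oracle_fun \<Rightarrow> real \<Rightarrow> nat \<Rightarrow> (nat \<Rightarrow> nat) \<Rightarrow> nat \<Rightarrow> vect" where
  "dual_iter P orc \<alpha> T s 0 = (\<lambda>_. 0)"
| "dual_iter P orc \<alpha> T s (Suc t) =
     pos_part (\<lambda>j. dual_iter P orc \<alpha> T s t j
       + \<alpha> * dual_dir P orc T s t (dual_iter P orc \<alpha> T s t) j)"

definition dual_avg ::
  "sep_problem \<Rightarrow> oracle_fun \<Rightarrow> real \<Rightarrow> nat \<Rightarrow> (nat \<Rightarrow> nat) \<Rightarrow> vect" where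
  "dual_avg P orc \<alpha> T s = (\<lambda>j. (1 / real T) * (\<Sum>t<T. dual_iter P orc \<alpha> T s t j))"

definition sampled :: "nat \<Rightarrow> (nat \<Rightarrow> nat) \<Rightarrow> nat \<Rightarrow> nat set" where
  "sampled T s i = {t. t < T - 1 \<and> s t = i}"

definition primal_avg ::
  "sep_problem \<Rightarrow> oracle_fun \<Rightarrow> real \<Rightarrow> nat \<Rightarrow> (nat \<Rightarrow> nat) \<Rightarrow> nat \<Rightarrow> vect" where
  "primal_avg P orc \<alpha> T s i =
     (\<lambda>j. (1 / (real (card (sampled T s i)) + 1)) *
        (orc i 1 (dual_iter P orc \<alpha> T s (T - 1)) j
         + (\<Sum>t \<in> sampled T s i. orc i 1 (dual_iter P orc \<alpha> T s t) j)))"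

text \<open>State of stage 2: the blocks \<open>(x\<^sub>i)\<close> (with hats), \<open>(\<beta>\<^sub>i)\<close> and \<open>(z\<^sub>i)\<close>.\<close>

type_synonym fw_state = "(nat \<Rightarrow> vect) \<times> (nat \<Rightarrow> real) \<times> (nat \<Rightarrow> vect)"

definition fw_init :: "sep_problem \<Rightarrow> (nat \<Rightarrow> vect) \<Rightarrow> fw_state" where
  "fw_init P x =
     (x, (\<lambda>i. (1 / real (nblocks P)) * hval P i (x i)),
         (\<lambda>i j. (1 / real (nblocks P)) * Ax P i (x i) j))"

text \<open>One step for the sampled block \<open>i\<close>, with stepsize \<open>\<rho>\<close> and dual value \<open>dv\<close>.\<close>

definition fw_step ::
  "sep_problem \<Rightarrow> oracle_fun \<Rightarrow> real \<Rightarrow> real \<Rightarrow> nat \<Rightarrow> fw_state \<Rightarrow> fw_state" where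
  "fw_step P orc dv \<rho> i = (\<lambda>(x, \<beta>, z).
     let N = nblocks P;
         \<gamma> = max ((\<Sum>l<N. \<beta> l) - dv) 0;
         g = pos_part (\<lambda>j. (\<Sum>l<N. z l j) - rhs P j);
         y = orc i \<gamma> g
     in (x(i := seg \<rho> (x i) y),
         \<beta>(i := (1 - \<rho>) * \<beta> i + \<rho> / real N * hval P i y),
         z(i := (\<lambda>j. (1 - \<rho>) * z i j + \<rho> / real N * Ax P i y j))))"

primrec fw_iter ::
  "sep_problem \<Rightarrow> oracle_fun \<Rightarrow> real \<Rightarrow> (nat \<Rightarrow> vect) \<Rightarrow> (nat \<Rightarrow> nat) \<Rightarrow> nat \<Rightarrow> fw_state" where
  "fw_iter P orc dv x0 r 0 = fw_init P x0"
| "fw_iter P orc dv x0 r (Suc k) =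
     fw_step P orc dv (2 * real (nblocks P) / (real k + 2 * real (nblocks P))) (r k)
       (fw_iter P orc dv x0 r k)"

definition two_stage_output ::
  "sep_problem \<Rightarrow> oracle_fun \<Rightarrow> real \<Rightarrow> nat \<Rightarrow> nat \<Rightarrow> (nat \<Rightarrow> nat) \<times> (nat \<Rightarrow> nat)
     \<Rightarrow> nat \<Rightarrow> vect" where
  "two_stage_output P orc \<Lambda> T K = (\<lambda>(s, r).
     let \<alpha> = \<Lambda> / (Gtilde P * sqrt (real T))
     in fst (fw_iter P orc (dual_fun P (dual_avg P orc \<alpha> T s)) (primal_avg P orc \<alpha> T s) r K))"

text \<open>
  All sampled indices are independent and uniform; outside of the sampled range the index
  functions have the irrelevant default value 0.
\<close>

definition unif_indices :: "nat \<Rightarrow> nat \<Rightarrow> (nat \<Rightarrow> nat) pmf" where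
  "unif_indices N n = Pi_pmf {..<n} 0 (\<lambda>_. pmf_of_set {..<N})"

definition run_pmf :: "nat \<Rightarrow> nat \<Rightarrow> nat \<Rightarrow> ((nat \<Rightarrow> nat) \<times> (nat \<Rightarrow> nat)) pmf" where
  "run_pmf N T K = pair_pmf (unif_indices N (T - 1)) (unif_indices N K)"

definition accurate_in_expectation ::
  "sep_problem \<Rightarrow> real \<Rightarrow> real \<Rightarrow> ((nat \<Rightarrow> nat) \<times> (nat \<Rightarrow> nat)) pmf
     \<Rightarrow> ((nat \<Rightarrow> nat) \<times> (nat \<Rightarrow> nat) \<Rightarrow> nat \<Rightarrow> vect) \<Rightarrow> bool" where
  "accurate_in_expectation P dstar \<epsilon> R out \<longleftrightarrow>
     (\<forall>\<omega> \<in> set_pmf R. \<forall>i<nblocks P. out \<omega> i \<in> Xset P i) \<and>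
     measure_pmf.expectation R (\<lambda>\<omega>. avg_obj P (out \<omega>)) \<le> dstar + \<epsilon> \<and>
     measure_pmf.expectation R (\<lambda>\<omega>. vnorm_plus (ncons P) (avg_residual P (out \<omega>))) \<le> \<epsilon>"

definition oracle_calls :: "nat \<Rightarrow> nat \<Rightarrow> nat \<Rightarrow> nat" where
  "oracle_calls N T K = (T - 1) + N + K"

end

theory Submission
  imports Defs
begin

text \<open>
  Let \<open>f\<close> be the norm of the positive part of the pair (objective minus dual value, constraint
  residual); it dominates both errors of the output.  In stage 2 the function \<open>f\<^sup>2\<close> is quadratic on
  its support, so the Frank-Wolfe gap is at least \<open>f\<^sup>2 - f \<Delta>\<close>, twice the usual bound up to the
  dual gap \<open>\<Delta> = d\<^sup>* - d(\<lambda>)\<close> of stage 1.  With \<open>n = k + 2 N\<close> one step gives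
  \<open>E f'\<^sup>2 \<le> (1 - 3/n) f\<^sup>2 + 4 \<Delta>\<^sup>2/n + 4 D\<^sup>2/n\<^sup>2\<close>, hence after \<open>K\<close> steps
  \<open>E f\<^sup>2 \<le> (2 N/(K + 2 N))\<^sup>3 f\<^sub>0\<^sup>2 + 2 \<Delta>\<^sup>2 + 4 D\<^sup>2/(K + 2 N)\<close>.  The cubic decay makes the crude bound
  \<open>f\<^sub>0 \<le> 2 H + G + \<Delta>\<close> on the primal averages of stage 1 sufficient, and the projected
  subgradient method gives \<open>E \<Delta> = O(1/\<surd>T)\<close>.  With \<open>K = T\<close> the expected error is
  \<open>O((N/T)\<^sup>3\<^sup>/\<^sup>2 + 1/\<surd>T)\<close>, which is at most \<open>\<epsilon>\<close> once \<open>T\<close> exceeds a multiple of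
  \<open>N/\<epsilon>\<^sup>2\<^sup>/\<^sup>3 + 1/\<epsilon>\<^sup>2\<close>.
\<close>

section \<open>Expectations over independently drawn block indices, one index at a time\<close>

section \<open>Independent uniform indices\<close>

lemma expectation_pair_pmf_finite:
  fixes f :: "'a \<times> 'b \<Rightarrow> real"
  assumes "finite (set_pmf p)" "finite (set_pmf q)"
  shows "measure_pmf.expectation (pair_pmf p q) f =
    measure_pmf.expectation p (\<lambda>x. measure_pmf.expectation q (\<lambda>y. f (x, y)))"
proof -
  have "pair_pmf p q = p \<bind> (\<lambda>x. map_pmf (Pair x) q)"
    by (simp add: pair_pmf_def map_pmf_def)
  then have "measure_pmf.expectation (pair_pmf p q) f =
      (\<Sum>a\<in>set_pmf p. pmf p a *\<^sub>R measure_pmf.expectation (map_pmf (Pair a) q) f)"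
    using assms by (simp only:) (subst pmf_expectation_bind[of "set_pmf p"], auto)
  also have "\<dots> = measure_pmf.expectation p (\<lambda>x. measure_pmf.expectation q (\<lambda>y. f (x, y)))"
    using assms by (subst integral_measure_pmf[of "set_pmf p"]) (auto simp: set_pmf_eq)
  finally show ?thesis .
qed

text \<open>Jensen's inequality for the square, read off from the nonnegativity of the
  variance.\<close>

lemma expectation_le_sqrt:
  fixes f :: "'a \<Rightarrow> real"
  assumes "finite (set_pmf p)"
  shows "measure_pmf.expectation p f \<le> sqrt (measure_pmf.expectation p (\<lambda>x. (f x)\<^sup>2))"
proof -
  have "0 \<le> measure_pmf.expectation p (\<lambda>x. (f x)\<^sup>2) - (measure_pmf.expectation p f)\<^sup>2"
    using measure_pmf.variance_positive[of p f]
    by (subst (asm) measure_pmf.variance_eq) (auto intro: integrable_measure_pmf_finite assms)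
  then show ?thesis
    by (intro real_le_rsqrt) simp
qed

lemma finite_set_unif_indices [simp]: "N > 0 \<Longrightarrow> finite (set_pmf (unif_indices N n))"
  unfolding unif_indices_def by (subst set_Pi_pmf)
    (auto intro!: finite_PiE_dflt simp: set_pmf_of_set lessThan_empty_iff)

lemma integrable_unif_indices [simp]:
  "N > 0 \<Longrightarrow> integrable (measure_pmf (unif_indices N n)) (f :: _ \<Rightarrow> real)"
  by (rule integrable_measure_pmf_finite) simp

lemma expectation_unif_indices_0:
  "measure_pmf.expectation (unif_indices N 0) f = (f (\<lambda>_. 0) :: real)"
  by (simp add: unif_indices_def)

text \<open>Tower property: index \<open>n\<close> is drawn after and independently of the indices
  below \<open>n\<close>, so the inner average is the conditional expectation given them. This turns
  the one-step bounds of both stages into bounds in expectation.\<close>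

lemma expectation_unif_indices_Suc:
  fixes f :: "_ \<Rightarrow> real"
  assumes "N > 0"
  shows "measure_pmf.expectation (unif_indices N (Suc n)) f =
    measure_pmf.expectation (unif_indices N n) (\<lambda>s. (1 / real N) * (\<Sum>i<N. f (s(n := i))))"
proof -
  have fin: "finite (set_pmf (Pi_pmf {..<n} 0 (\<lambda>_. pmf_of_set {..<N})))"
    using finite_set_unif_indices[OF assms, of n] by (simp add: unif_indices_def)
  have ne: "{..<N} \<noteq> {}"
    using assms by auto
  have "measure_pmf.expectation (unif_indices N (Suc n)) f =
      measure_pmf.expectation (pair_pmf (pmf_of_set {..<N}) (unif_indices N n)) (\<lambda>(y, s). f (s(n := y)))"
    unfolding unif_indices_def lessThan_Suc by (subst Pi_pmf_insert) (auto simp: case_prod_unfold)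
  also have "\<dots> = measure_pmf.expectation (pmf_of_set {..<N})
      (\<lambda>i. measure_pmf.expectation (unif_indices N n) (\<lambda>s. f (s(n := i))))"
    using assms ne by (subst expectation_pair_pmf_finite) auto
  also have "\<dots> = (1 / real N) * (\<Sum>i<N. measure_pmf.expectation (unif_indices N n) (\<lambda>s. f (s(n := i))))"
    using ne by (subst integral_pmf_of_set) auto
  also have "\<dots> = measure_pmf.expectation (unif_indices N n) (\<lambda>s. (1 / real N) * (\<Sum>i<N. f (s(n := i))))"
    using assms by simp
  finally show ?thesis .
qed

section \<open>Convex combinations, diameters of hulls, coordinate bounds from compactness\<close>

section \<open>Convexity and boundedness\<close>

text \<open>The separate point \<open>p0\<close> matches the shape of \<open>primal_avg\<close>: the
  point of the last iteration of stage 1 is always present, even for a block that was never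
  sampled.\<close>

lemma convex_set_average:
  assumes "convex_set S" "finite A" "p0 \<in> S" "\<And>a. a \<in> A \<Longrightarrow> p a \<in> S"
  shows "(\<lambda>j. (1 / (real (card A) + 1)) * (p0 j + (\<Sum>a\<in>A. p a j))) \<in> S"
  using assms(2,4)
proof (induction A rule: finite_induct)
  case empty
  then show ?case using assms(3) by simp
next
  case (insert a A)
  let ?q = "\<lambda>j. (1 / (real (card A) + 1)) * (p0 j + (\<Sum>a\<in>A. p a j))"
  \<comment> \<open>The new point gets the share of one among \<open>card A + 2\<close> points:
    \<open>p0\<close>, those of \<open>A\<close>, and itself.\<close>
  have "seg (1 / (real (card A) + 2)) ?q (p a) \<in> S"
    using insert assms(1) unfolding convex_set_def by auto
  also have "seg (1 / (real (card A) + 2)) ?q (p a) =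
      (\<lambda>j. (1 / (real (card (insert a A)) + 1)) * (p0 j + (\<Sum>a\<in>insert a A. p a j)))"
    using insert by (intro ext) (simp add: seg_def divide_simps, simp add: algebra_simps)
  finally show ?case .
qed

lemma convex_set_hull: "convex_set (convex_set hull S)"
  by (rule hull_in) (auto simp: convex_set_def)

lemma vnorm_le_sum: "vnorm n x \<le> (\<Sum>j<n. \<bar>x j\<bar>)"
  by (simp add: vnorm_def L2_set_le_sum_abs)

text \<open>A real supremum dominates its members only if they are bounded above. A coordinate box
  is convex, so a bound on \<open>S\<close> passes to the hull and bounds all distances
  there.\<close>

lemma vnorm_hull_diff_le_diam:
  assumes bound: "\<And>p j. p \<in> S \<Longrightarrow> j < n \<Longrightarrow> \<bar>p j\<bar> \<le> B"
    and "p \<in> convex_set hull S" "q \<in> convex_set hull S"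
  shows "vnorm n (\<lambda>j. p j - q j) \<le> diam n (convex_set hull S)"
proof -
  let ?box = "{p. \<forall>j<n. \<bar>p j\<bar> \<le> B}"
  have "convex_set ?box"
    unfolding convex_set_def
  proof clarsimp
    fix x y :: vect and t :: real and j
    assume x: "\<forall>j<n. \<bar>x j\<bar> \<le> B" and y: "\<forall>j<n. \<bar>y j\<bar> \<le> B" and t: "0 \<le> t" "t \<le> 1" and j: "j < n"
    have "\<bar>seg t x y j\<bar> \<le> \<bar>(1 - t) * x j\<bar> + \<bar>t * y j\<bar>"
      unfolding seg_def by (rule abs_triangle_ineq)
    also have "\<dots> = (1 - t) * \<bar>x j\<bar> + t * \<bar>y j\<bar>"
      using t by (simp add: abs_mult)
    also have "\<dots> \<le> (1 - t) * B + t * B"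
      using t x y j by (intro add_mono mult_left_mono) auto
    finally show "\<bar>seg t x y j\<bar> \<le> B"
      by (simp add: algebra_simps)
  qed
  then have sub: "convex_set hull S \<subseteq> ?box"
    using bound by (intro hull_minimal) auto
  have "bdd_above ((\<lambda>(x, y). vnorm n (\<lambda>j. x j - y j)) `
      ((convex_set hull S) \<times> (convex_set hull S)))"
  proof (rule bdd_aboveI2, clarify)
    fix x y assume "x \<in> convex_set hull S" "y \<in> convex_set hull S"
    then have "\<forall>j<n. \<bar>x j\<bar> \<le> B" "\<forall>j<n. \<bar>y j\<bar> \<le> B"
      using sub by auto
    then have "\<bar>x j - y j\<bar> \<le> 2 * B" if "j < n" for j
      using that abs_triangle_ineq4[of "x j" "y j"] by (metis add_mono mult_2 order_trans)
    then have "(\<Sum>j<n. \<bar>x j - y j\<bar>) \<le> (\<Sum>j<n. 2 * B)"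
      by (intro sum_mono) auto
    then show "vnorm n (\<lambda>j. x j - y j) \<le> (\<Sum>j<n. 2 * B)"
      using vnorm_le_sum[of n "\<lambda>j. x j - y j"] by linarith
  qed
  then have "(\<lambda>(x, y). vnorm n (\<lambda>j. x j - y j)) (p, q)
      \<le> (SUP z\<in>(convex_set hull S) \<times> (convex_set hull S). (\<lambda>(x, y). vnorm n (\<lambda>j. x j - y j)) z)"
    by (rule cSUP_upper[rotated]) (use assms in auto)
  then show ?thesis
    unfolding diam_def by simp
qed

lemma compactin_Euclidean_space_coord_bounded:
  assumes "compactin (Euclidean_space d) S"
  shows "\<exists>B. \<forall>x\<in>S. \<forall>k<d. \<bar>x k\<bar> \<le> B"
proof -
  have "\<exists>B. \<forall>x\<in>S. \<bar>x k\<bar> \<le> B" for k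
  proof -
    have "continuous_map (Euclidean_space d) euclideanreal (\<lambda>x. x k)"
      unfolding Euclidean_space_def
      by (intro continuous_map_from_subtopology continuous_map_product_projection) auto
    then have "compactin euclideanreal ((\<lambda>x. x k) ` S)"
      using assms by (rule image_compactin[rotated])
    then have "bounded ((\<lambda>x. x k) ` S)"
      by (simp add: compact_imp_bounded)
    then show ?thesis
      by (auto simp: bounded_iff)
  qed
  then obtain B where B: "\<And>k x. x \<in> S \<Longrightarrow> \<bar>x k\<bar> \<le> B k"
    by metis
  have "\<bar>x k\<bar> \<le> (\<Sum>k<d. \<bar>B k\<bar>)" if "x \<in> S" "k < d" for x k
  proof -
    have "\<bar>x k\<bar> \<le> \<bar>B k\<bar>"
      using B[OF that(1), of k] by linarith
    also have "\<dots> \<le> (\<Sum>k<d. \<bar>B k\<bar>)"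
      using that(2) by (intro member_le_sum) auto
    finally show ?thesis .
  qed
  then show ?thesis by blast
qed

section \<open>Bounds on the problem data and elementary facts about the oracle\<close>

section \<open>The separable problem and its dual\<close>

text \<open>A convex lower semicontinuous function can be unbounded above on a compact domain, so
  finiteness of H is assumed separately; it makes \<open>Hsup\<close> a genuine bound.\<close>

locale separable_problem =
  fixes P :: sep_problem and orc :: oracle_fun
  assumes problem: "sep_convex_problem P"
    and orc_min: "is_oracle P orc"
    and bdd_obj: "bdd_above (Hvals P)"
begin

abbreviation N :: nat where "N \<equiv> nblocks P"
abbreviation m :: nat where "m \<equiv> ncons P"
abbreviation b :: vect where "b \<equiv> rhs P"

lemma N_pos: "N > 0"
  using problem by (auto simp: sep_convex_problem_def)

lemma rhs_rvec: "b \<in> rvec m"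
  using problem by (auto simp: sep_convex_problem_def)

lemma Ax_outside: "j \<ge> m \<Longrightarrow> Ax P i x j = 0"
  by (simp add: Ax_def matvec_def)

lemma orc_in: "i < N \<Longrightarrow> \<gamma> \<ge> 0 \<Longrightarrow> l \<in> rvec m \<Longrightarrow> orc i \<gamma> l \<in> Xset P i"
  using orc_min by (auto simp: is_oracle_def is_arg_min_def)

lemma orc_le:
  assumes "i < N" "\<gamma> \<ge> 0" "l \<in> rvec m" "x \<in> Xset P i"
  shows "\<gamma> * hval P i (orc i \<gamma> l) + dot m l (Ax P i (orc i \<gamma> l)) \<le> \<gamma> * hval P i x + dot m l (Ax P i x)"
proof -
  have "is_arg_min (\<lambda>x. \<gamma> * hval P i x + dot m l (Ax P i x)) (\<lambda>x. x \<in> Xset P i) (orc i \<gamma> l)"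
    using orc_min assms(1-3) unfolding is_oracle_def by blast
  then show ?thesis
    using assms(4) by (auto simp: is_arg_min_linorder)
qed

lemma hval_bound: "i < N \<Longrightarrow> x \<in> Xset P i \<Longrightarrow> \<bar>hval P i x\<bar> \<le> Hsup P"
  unfolding Hsup_def by (rule cSup_upper[OF _ bdd_obj]) (force simp: Hvals_def)

lemma Xset_nonempty: "i < N \<Longrightarrow> Xset P i \<noteq> {}"
  using problem by (auto simp: sep_convex_problem_def proper_fun_def Xset_def)

lemma Hsup_nonneg: "Hsup P \<ge> 0"
  using N_pos Xset_nonempty[of 0] hval_bound[of 0] by fastforce

lemma Xset_seg: "i < N \<Longrightarrow> x \<in> Xset P i \<Longrightarrow> y \<in> Xset P i \<Longrightarrow> 0 \<le> t \<Longrightarrow> t \<le> 1 \<Longrightarrow> seg t x y \<in> Xset P i"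
  using problem by (auto simp: sep_convex_problem_def convex_set_def)

lemma obj_eq_hval:
  assumes "i < N" "x \<in> Xset P i"
  shows "obj P i x = ereal (hval P i x)"
proof -
  have "obj P i x \<noteq> -\<infinity>" "obj P i x < \<infinity>"
    using problem assms by (auto simp: sep_convex_problem_def proper_fun_def Xset_def eff_dom_def)
  then show ?thesis
    unfolding hval_def by (cases "obj P i x") auto
qed

lemma hval_seg_le:
  assumes i: "i < N" and x: "x \<in> Xset P i" and y: "y \<in> Xset P i" and t: "0 \<le> t" "t \<le> 1"
  shows "hval P i (seg t x y) \<le> (1 - t) * hval P i x + t * hval P i y"
proof -
  \<comment> \<open>\<open>convex_fun\<close> speaks about the open interval, so the endpoints are
    treated apart.\<close>
  consider "t = 0" | "t = 1" | "t \<in> {0<..<1}"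
    using t by fastforce
  then show ?thesis
  proof cases
    case 3
    have "obj P i (seg t x y) \<le> ereal (1 - t) * obj P i x + ereal t * obj P i y"
      using problem 3 i x y
      by (auto simp: sep_convex_problem_def convex_fun_def Xset_def eff_dom_def)
    then show ?thesis
      using obj_eq_hval[OF i x] obj_eq_hval[OF i y] obj_eq_hval[OF i Xset_seg[OF i x y t]] by simp
  qed (auto simp: seg_def)
qed

lemma Ax_seg: "Ax P i (seg t x y) j = (1 - t) * Ax P i x j + t * Ax P i y j"
  by (simp add: Ax_def matvec_def seg_def sum_distrib_left sum.distrib[symmetric] algebra_simps)

lemma Ax_bounded: "i < N \<Longrightarrow> \<exists>B. \<forall>x\<in>Xset P i. \<forall>j. \<bar>Ax P i x j\<bar> \<le> B"
proof -
  assume i: "i < N"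
  then have "compactin (Euclidean_space (bdim P i)) (Xset P i)"
    using problem by (auto simp: sep_convex_problem_def)
  then obtain B where B: "\<And>x k. x \<in> Xset P i \<Longrightarrow> k < bdim P i \<Longrightarrow> \<bar>x k\<bar> \<le> B"
    using compactin_Euclidean_space_coord_bounded by metis
  let ?c = "\<Sum>j<m. \<Sum>k<bdim P i. \<bar>cmat P i j k\<bar> * \<bar>B\<bar>"
  have "\<bar>Ax P i x j\<bar> \<le> ?c" if x: "x \<in> Xset P i" for x j
  proof (cases "j < m")
    case True
    have "\<bar>Ax P i x j\<bar> \<le> (\<Sum>k<bdim P i. \<bar>cmat P i j k * x k\<bar>)"
      using True by (simp add: Ax_def matvec_def sum_abs)
    also have "\<dots> \<le> (\<Sum>k<bdim P i. \<bar>cmat P i j k\<bar> * \<bar>B\<bar>)"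
      using B[OF x] by (intro sum_mono) (fastforce simp: abs_mult intro: mult_left_mono)
    also have "\<dots> \<le> ?c"
      using True by (intro member_le_sum[of j "{..<m}"]) (auto intro!: sum_nonneg)
    finally show ?thesis .
  qed (auto simp: Ax_outside intro!: sum_nonneg)
  then show ?thesis by blast
qed

text \<open>The supremum in \<open>Gtilde\<close> must first be shown finite: compactness bounds
  \<open>Ax\<close> on each block, and summing these bounds over the finitely many blocks makes them
  uniform.\<close>

lemma residual_bound:
  assumes "i < N" "x \<in> Xset P i"
  shows "vnorm m (\<lambda>j. Ax P i x j - b j) \<le> Gtilde P"
proof -
  obtain B where B: "\<And>i x j. i < N \<Longrightarrow> x \<in> Xset P i \<Longrightarrow> \<bar>Ax P i x j\<bar> \<le> B i"
    using Ax_bounded by metis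
  have "bdd_above ((\<lambda>(i, x). vnorm m (\<lambda>j. Ax P i x j - b j)) ` (SIGMA i : {..<N}. Xset P i))"
  proof (rule bdd_aboveI2, clarify)
    fix i x assume i: "i < N" and x: "x \<in> Xset P i"
    have "B i \<le> (\<Sum>i<N. \<bar>B i\<bar>)"
      using i member_le_sum[of i "{..<N}" "\<lambda>i. \<bar>B i\<bar>"] by auto
    then have "\<bar>Ax P i x j - b j\<bar> \<le> (\<Sum>i<N. \<bar>B i\<bar>) + \<bar>b j\<bar>" for j
      using B[of i x j] i x by fastforce
    then have "(\<Sum>j<m. \<bar>Ax P i x j - b j\<bar>) \<le> (\<Sum>j<m. (\<Sum>i<N. \<bar>B i\<bar>) + \<bar>b j\<bar>)"
      by (rule sum_mono)
    then show "vnorm m (\<lambda>j. Ax P i x j - b j) \<le> (\<Sum>j<m. (\<Sum>i<N. \<bar>B i\<bar>) + \<bar>b j\<bar>)"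
      by - (rule order_trans[OF vnorm_le_sum])
  qed
  then have "(\<lambda>(i, x). vnorm m (\<lambda>j. Ax P i x j - b j)) (i, x) \<le> Gtilde P"
    unfolding Gtilde_def using assms by (intro cSUP_upper) auto
  then show ?thesis by simp
qed

lemma Gtilde_nonneg: "Gtilde P \<ge> 0"
proof -
  obtain x where "x \<in> Xset P 0"
    using Xset_nonempty[OF N_pos] by blast
  from residual_bound[OF N_pos this] show ?thesis
    by (simp add: vnorm_def) (meson L2_set_nonneg order_trans)
qed

lemma Cset_hull_diff:
  assumes i: "i < N" and "p \<in> convex_set hull Cset P i" "q \<in> convex_set hull Cset P i"
  shows "vnorm (Suc m) (\<lambda>j. p j - q j) \<le> diam (Suc m) (convex_set hull Cset P i)"
proof -
  obtain B where B: "\<And>x j. x \<in> Xset P i \<Longrightarrow> \<bar>Ax P i x j\<bar> \<le> B"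
    using Ax_bounded[OF i] by blast
  have "\<bar>c j\<bar> \<le> max (Hsup P) B" if "c \<in> Cset P i" for c j
    using that B hval_bound[OF i] by (cases j) (fastforce simp: Cset_def le_max_iff_disj)+
  then show ?thesis
    using assms(2,3) by (rule vnorm_hull_diff_le_diam)
qed

section \<open>The Lagrangian, weak duality and concavity of the dual function\<close>

definition lagrangian :: "(nat \<Rightarrow> vect) \<Rightarrow> vect \<Rightarrow> real" where
  "lagrangian x l = avg_obj P x + dot m l (avg_residual P x)"

text \<open>Read from right to left, this is the unbiasedness of the direction obtained from one
  uniformly sampled block.\<close>

lemma dot_avg_residual:
  "dot m l (avg_residual P x) = (1 / real N) * (\<Sum>i<N. dot m l (\<lambda>j. Ax P i (x i) j - b j))"
proof -
  have "(\<Sum>i<N. dot m l (\<lambda>j. Ax P i (x i) j - b j)) = (\<Sum>j<m. \<Sum>i<N. l j * (Ax P i (x i) j - b j))"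
    unfolding dot_def by (rule sum.swap)
  also have "\<dots> = (\<Sum>j<m. real N * (l j * avg_residual P x j))"
    using N_pos by (intro sum.cong)
      (auto simp: avg_residual_def sum_distrib_left[symmetric] sum_subtractf field_simps)
  finally show ?thesis
    using N_pos by (simp add: dot_def sum_distrib_left[symmetric])
qed

lemma lagrangian_eq:
  "lagrangian x l = - dot m l b + (1 / real N) * (\<Sum>i<N. hval P i (x i) + dot m l (Ax P i (x i)))"
proof -
  have e: "(\<Sum>i<N. dot m l (\<lambda>j. Ax P i (x i) j - b j)) = (\<Sum>i<N. dot m l (Ax P i (x i))) - real N * dot m l b"
    by (simp add: dot_def sum_subtractf right_diff_distrib)
  show ?thesis
    using N_pos unfolding lagrangian_def dot_avg_residual avg_obj_def e
    by (simp add: sum.distrib field_simps)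
qed

text \<open>The Lagrangian is affine in the multiplier with slope \<open>avg_residual\<close>; at a
  minimizer of the Lagrangian this slope is therefore a supergradient of the dual function.\<close>

lemma lagrangian_diff: "lagrangian x l' = lagrangian x l + dot m (\<lambda>j. l' j - l j) (avg_residual P x)"
  by (simp add: lagrangian_def dot_def sum_subtractf left_diff_distrib)

lemma dual_fun_le_lagrangian:
  assumes l: "l \<in> rvec m" and x: "\<And>i. i < N \<Longrightarrow> x i \<in> Xset P i"
  shows "dual_fun P l \<le> lagrangian x l"
proof -
  have "(INF x \<in> Xset P i. hval P i x + dot m l (Ax P i x)) \<le> hval P i (x i) + dot m l (Ax P i (x i))"
    if "i < N" for i
  proof (rule cINF_lower)
    show "bdd_below ((\<lambda>x. hval P i x + dot m l (Ax P i x)) ` Xset P i)"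
      using orc_le[OF that, of 1 l] l by (intro bdd_belowI2) auto
  qed (rule x[OF that])
  then show ?thesis
    unfolding lagrangian_eq dual_fun_def by (intro add_left_mono mult_left_mono sum_mono) auto
qed

lemma dual_fun_eq_lagrangian:
  assumes l: "l \<in> rvec m"
  shows "dual_fun P l = lagrangian (\<lambda>i. orc i 1 l) l"
proof -
  have "(INF x \<in> Xset P i. hval P i x + dot m l (Ax P i x))
      = hval P i (orc i 1 l) + dot m l (Ax P i (orc i 1 l))" if "i < N" for i
    using orc_le[OF that, of 1 l] l orc_in[OF that, of 1 l]
    by (intro cInf_eq_minimum) auto
  then show ?thesis
    unfolding lagrangian_eq dual_fun_def by auto
qed

text \<open>Jensen's inequality for the concave dual function. With \<open>x\<close> a minimizer at
  the averaged multiplier, the Lagrangian at \<open>x\<close> is affine in the multiplier, lies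
  above the dual function, and touches it at the average.\<close>

lemma dual_fun_avg_ge:
  assumes n: "n > 0" and l: "\<And>t. t < n \<Longrightarrow> l t \<in> rvec m"
  shows "(1 / real n) * (\<Sum>t<n. dual_fun P (l t)) \<le> dual_fun P (\<lambda>j. (1 / real n) * (\<Sum>t<n. l t j))"
proof -
  define la where "la = (\<lambda>j. (1 / real n) * (\<Sum>t<n. l t j))"
  define x where "x = (\<lambda>i. orc i 1 la)"
  have la: "la \<in> rvec m"
    using l by (auto simp: la_def topspace_Euclidean_space)
  have "(\<Sum>t<n. dot m (l t) (avg_residual P x)) = real n * dot m la (avg_residual P x)"
    using n unfolding dot_def la_def
    by (subst sum.swap) (simp add: sum_distrib_left sum_distrib_right)
  then have "(\<Sum>t<n. lagrangian x (l t)) = real n * lagrangian x la"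
    by (simp add: lagrangian_def sum.distrib algebra_simps)
  moreover have "(\<Sum>t<n. dual_fun P (l t)) \<le> (\<Sum>t<n. lagrangian x (l t))"
    using l la by (intro sum_mono dual_fun_le_lagrangian) (auto simp: x_def orc_in)
  moreover have "lagrangian x la = dual_fun P la"
    using dual_fun_eq_lagrangian[OF la] by (simp add: x_def)
  ultimately show ?thesis
    unfolding la_def[symmetric] using n by (simp add: field_simps)
qed

end

section \<open>Projected stochastic subgradient ascent and its expected dual gap\<close>

section \<open>Stage 1\<close>

locale strongly_dual_problem = separable_problem +
  fixes lstar :: vect
  assumes maximizer: "dual_maximizer P lstar"
    and strong_duality: "ereal (dual_fun P lstar) = primal_value P"
begin

abbreviation dstar :: real where "dstar \<equiv> dual_fun P lstar"

lemma lstar_rvec: "lstar \<in> rvec m" and lstar_nonneg: "j < m \<Longrightarrow> 0 \<le> lstar j"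
  using maximizer by (auto simp: dual_maximizer_def is_arg_max_def nonneg_vecs_def)

lemma dual_fun_le_dstar: "l \<in> nonneg_vecs m \<Longrightarrow> dual_fun P l \<le> dstar"
  using maximizer by (auto simp: dual_maximizer_def is_arg_max_linorder)

lemma average_add_const: "(1 / real N) * (\<Sum>i<N. f i + c) = (1 / real N) * (\<Sum>i<N. f i) + c"
  using N_pos by (simp add: sum.distrib field_simps)

text \<open>The classical distance recursion of the projected subgradient method, averaged over the
  sampled block: clipping does not increase the distance to \<open>lstar\<close>, the sampled
  directions average to a supergradient, and \<open>Gtilde\<close> bounds their length.\<close>

lemma subgradient_step:
  assumes l: "l \<in> rvec m" and \<alpha>: "\<alpha> \<ge> 0"
  defines "g \<equiv> \<lambda>i j. Ax P i (orc i 1 l) j - b j"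
  shows "(1 / real N) * (\<Sum>i<N. \<Sum>j<m. (pos_part (\<lambda>j. l j + \<alpha> * g i j) j - lstar j)\<^sup>2)
    \<le> (\<Sum>j<m. (l j - lstar j)\<^sup>2) - 2 * \<alpha> * (dstar - dual_fun P l) + \<alpha>\<^sup>2 * (Gtilde P)\<^sup>2"
proof -
  let ?v = "\<lambda>j. l j - lstar j"
  have step: "(\<Sum>j<m. (pos_part (\<lambda>j. l j + \<alpha> * g i j) j - lstar j)\<^sup>2)
      \<le> (\<Sum>j<m. (l j - lstar j)\<^sup>2) + 2 * \<alpha> * dot m ?v (g i) + \<alpha>\<^sup>2 * (Gtilde P)\<^sup>2"
    if i: "i < N" for i
  proof -
    have "(pos_part (\<lambda>j. l j + \<alpha> * g i j) j - lstar j)\<^sup>2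
        \<le> (?v j)\<^sup>2 + 2 * \<alpha> * (?v j * g i j) + \<alpha>\<^sup>2 * (g i j)\<^sup>2" if "j < m" for j
    proof -
      \<comment> \<open>Since \<open>lstar j\<close> is nonnegative, projecting onto the half-line
        brings the coordinate no farther from it.\<close>
      have "\<bar>max (l j + \<alpha> * g i j) 0 - lstar j\<bar> \<le> \<bar>l j + \<alpha> * g i j - lstar j\<bar>"
        using lstar_nonneg[OF that] by linarith
      then have "(max (l j + \<alpha> * g i j) 0 - lstar j)\<^sup>2 \<le> (l j + \<alpha> * g i j - lstar j)\<^sup>2"
        by (simp only: abs_le_square_iff)
      also have "\<dots> = (?v j)\<^sup>2 + 2 * \<alpha> * (?v j * g i j) + \<alpha>\<^sup>2 * (g i j)\<^sup>2"
        by (simp add: power2_eq_square algebra_simps)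
      finally show ?thesis
        by (simp only: pos_part_def)
    qed
    then have "(\<Sum>j<m. (pos_part (\<lambda>j. l j + \<alpha> * g i j) j - lstar j)\<^sup>2)
        \<le> (\<Sum>j<m. (?v j)\<^sup>2 + 2 * \<alpha> * (?v j * g i j) + \<alpha>\<^sup>2 * (g i j)\<^sup>2)"
      by (intro sum_mono) simp
    also have "\<dots> = (\<Sum>j<m. (?v j)\<^sup>2) + 2 * \<alpha> * dot m ?v (g i) + \<alpha>\<^sup>2 * (vnorm m (g i))\<^sup>2"
      by (simp add: sum.distrib sum_distrib_left dot_def vnorm_def L2_set_def sum_nonneg)
    also have "\<dots> \<le> (\<Sum>j<m. (?v j)\<^sup>2) + 2 * \<alpha> * dot m ?v (g i) + \<alpha>\<^sup>2 * (Gtilde P)\<^sup>2"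
      using residual_bound[OF i orc_in[OF i _ l, of 1]]
      by (intro add_left_mono mult_left_mono power_mono) (auto simp: g_def vnorm_def)
    finally show ?thesis .
  qed
  have "(1 / real N) * (\<Sum>i<N. \<Sum>j<m. (pos_part (\<lambda>j. l j + \<alpha> * g i j) j - lstar j)\<^sup>2)
      \<le> (1 / real N) * (\<Sum>i<N. (\<Sum>j<m. (l j - lstar j)\<^sup>2) + 2 * \<alpha> * dot m ?v (g i) + \<alpha>\<^sup>2 * (Gtilde P)\<^sup>2)"
    using step by (intro mult_left_mono sum_mono) auto
  also have "\<dots> = (\<Sum>j<m. (l j - lstar j)\<^sup>2) + 2 * \<alpha> * ((1 / real N) * (\<Sum>i<N. dot m ?v (g i))) + \<alpha>\<^sup>2 * (Gtilde P)\<^sup>2"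
    using N_pos by (simp add: sum.distrib sum_distrib_left[symmetric] field_simps)
  also have "(1 / real N) * (\<Sum>i<N. dot m ?v (g i)) = dot m ?v (avg_residual P (\<lambda>i. orc i 1 l))"
    by (simp only: dot_avg_residual g_def)
  also have "(\<Sum>j<m. (l j - lstar j)\<^sup>2) + 2 * \<alpha> * dot m ?v (avg_residual P (\<lambda>i. orc i 1 l)) + \<alpha>\<^sup>2 * (Gtilde P)\<^sup>2
      \<le> (\<Sum>j<m. (l j - lstar j)\<^sup>2) + 2 * \<alpha> * (dual_fun P l - dstar) + \<alpha>\<^sup>2 * (Gtilde P)\<^sup>2"
  proof -
    \<comment> \<open>The supergradient inequality: weak duality at \<open>lstar\<close>, for the
      minimizers that attain the dual value at \<open>l\<close>.\<close>
    have "dstar \<le> lagrangian (\<lambda>i. orc i 1 l) lstar"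
      using l by (intro dual_fun_le_lagrangian lstar_rvec) (auto intro: orc_in)
    then have "dot m ?v (avg_residual P (\<lambda>i. orc i 1 l)) \<le> dual_fun P l - dstar"
      using dual_fun_eq_lagrangian[OF l] lagrangian_diff[of "\<lambda>i. orc i 1 l" l lstar] by simp
    then show ?thesis
      using \<alpha> by (intro add_right_mono add_left_mono mult_left_mono) auto
  qed
  finally show ?thesis
    by (simp add: algebra_simps)
qed

lemma dual_iter_nonneg: "dual_iter P orc \<alpha> T s t \<in> nonneg_vecs m"
proof (induction t)
  case (Suc t)
  then show ?case
    using rhs_rvec
    by (auto simp: nonneg_vecs_def topspace_Euclidean_space pos_part_def dual_dir_def avg_residual_def Ax_outside)
qed (auto simp: nonneg_vecs_def topspace_Euclidean_space)

lemma dual_iter_rvec: "dual_iter P orc \<alpha> T s t \<in> rvec m"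
  using dual_iter_nonneg[of \<alpha> T s t] by (auto simp: nonneg_vecs_def)

lemma dual_avg_nonneg: "dual_avg P orc \<alpha> T s \<in> nonneg_vecs m"
  using dual_iter_nonneg
  by (fastforce simp: nonneg_vecs_def topspace_Euclidean_space dual_avg_def intro!: divide_nonneg_nonneg sum_nonneg)

text \<open>An iterate reads only indices of earlier times, so redrawing index \<open>n\<close>
  leaves everything up to time \<open>n\<close> unchanged.\<close>

lemma dual_iter_upd: "t \<le> n \<Longrightarrow> dual_iter P orc \<alpha> T (s(n := i)) t = dual_iter P orc \<alpha> T s t"
  by (induction t) (auto simp: dual_dir_def)

text \<open>The bound on \<open>n\<close> excludes the last iteration, whose direction averages all
  blocks instead of using a sample.\<close>

lemma dual_iter_Suc_upd:
  assumes "Suc n < T"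
  shows "dual_iter P orc \<alpha> T (s(n := i)) (Suc n) =
    pos_part (\<lambda>j. dual_iter P orc \<alpha> T s n j + \<alpha> * (Ax P i (orc i 1 (dual_iter P orc \<alpha> T s n)) j - b j))"
  using assms by (simp add: dual_iter_upd dual_dir_def)

abbreviation stage1_gap :: "real \<Rightarrow> nat \<Rightarrow> (nat \<Rightarrow> nat) \<Rightarrow> nat \<Rightarrow> real" where
  "stage1_gap \<alpha> T s t \<equiv> dstar - dual_fun P (dual_iter P orc \<alpha> T s t)"

abbreviation dist_lstar :: "vect \<Rightarrow> real" where
  "dist_lstar l \<equiv> \<Sum>j<m. (l j - lstar j)\<^sup>2"

text \<open>By \<open>subgradient_step\<close>, the squared distance plus the weighted sum of past
  gaps grows by at most \<open>\<alpha>\<^sup>2 * (Gtilde P)\<^sup>2\<close> per step in conditional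
  expectation. The start at 0 gives the term with the norm of \<open>lstar\<close>.\<close>

lemma stage1_potential:
  assumes \<alpha>: "\<alpha> \<ge> 0" and "n < T"
  shows "measure_pmf.expectation (unif_indices N n)
      (\<lambda>s. dist_lstar (dual_iter P orc \<alpha> T s n) + 2 * \<alpha> * (\<Sum>t<n. stage1_gap \<alpha> T s t))
    \<le> (vnorm m lstar)\<^sup>2 + real n * (\<alpha>\<^sup>2 * (Gtilde P)\<^sup>2)"
  using assms(2)
proof (induction n)
  case 0
  then show ?case
    by (simp add: expectation_unif_indices_0 vnorm_def L2_set_def sum_nonneg)
next
  case (Suc n)
  let ?l = "\<lambda>s. dual_iter P orc \<alpha> T s n"
  let ?S = "\<lambda>s. 2 * \<alpha> * (\<Sum>t<n. stage1_gap \<alpha> T s t)"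
  let ?E = "measure_pmf.expectation (unif_indices N n)"
  let ?c = "\<alpha>\<^sup>2 * (Gtilde P)\<^sup>2"
  have gap: "(\<Sum>t<Suc n. stage1_gap \<alpha> T (s(n := i)) t) = (\<Sum>t<Suc n. stage1_gap \<alpha> T s t)" for s i
    by (intro sum.cong refl) (subst dual_iter_upd, auto)
  have "(1 / real N) * (\<Sum>i<N. dist_lstar (dual_iter P orc \<alpha> T (s(n := i)) (Suc n))
        + 2 * \<alpha> * (\<Sum>t<Suc n. stage1_gap \<alpha> T (s(n := i)) t))
      = (1 / real N) * (\<Sum>i<N. dist_lstar (dual_iter P orc \<alpha> T (s(n := i)) (Suc n)))
        + 2 * \<alpha> * (\<Sum>t<Suc n. stage1_gap \<alpha> T s t)" for s
    unfolding gap by (rule average_add_const)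
  also have "\<dots> s \<le> dist_lstar (?l s) - 2 * \<alpha> * stage1_gap \<alpha> T s n + ?c
        + 2 * \<alpha> * (\<Sum>t<Suc n. stage1_gap \<alpha> T s t)" for s
    using subgradient_step[OF dual_iter_rvec \<alpha>, of \<alpha> T s n]
    unfolding dual_iter_Suc_upd[OF Suc.prems] by (rule add_right_mono)
  also have "\<dots> s = (dist_lstar (?l s) + ?S s) + ?c" for s
    by (simp add: algebra_simps)
  finally have step: "(1 / real N) * (\<Sum>i<N. dist_lstar (dual_iter P orc \<alpha> T (s(n := i)) (Suc n))
        + 2 * \<alpha> * (\<Sum>t<Suc n. stage1_gap \<alpha> T (s(n := i)) t)) \<le> (dist_lstar (?l s) + ?S s) + ?c" for s .
  have "measure_pmf.expectation (unif_indices N (Suc n))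
      (\<lambda>s. dist_lstar (dual_iter P orc \<alpha> T s (Suc n)) + 2 * \<alpha> * (\<Sum>t<Suc n. stage1_gap \<alpha> T s t))
      \<le> ?E (\<lambda>s. (dist_lstar (?l s) + ?S s) + ?c)"
    unfolding expectation_unif_indices_Suc[OF N_pos]
    by (intro integral_mono integrable_unif_indices N_pos step)
  also have "\<dots> = ?E (\<lambda>s. dist_lstar (?l s) + ?S s) + ?c"
    by (subst Bochner_Integration.integral_add) (simp_all only: integrable_unif_indices N_pos, simp)
  also have "\<dots> \<le> (vnorm m lstar)\<^sup>2 + real n * ?c + ?c"
    using Suc by simp
  finally show ?case
    by (simp add: algebra_simps)
qed

text \<open>Covers the degenerate stepsize, which division by zero sets to 0. All residuals then
  vanish, the Lagrangian no longer depends on the multiplier, and every multiplier is as good as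
  \<open>lstar\<close>.\<close>

lemma dstar_le_dual_fun_if_Gtilde_0:
  assumes "Gtilde P = 0" and l: "l \<in> rvec m"
  shows "dstar \<le> dual_fun P l"
proof -
  let ?x = "\<lambda>i. orc i 1 l"
  have "Ax P i (?x i) j - b j = 0" if "i < N" "j < m" for i j
  proof -
    have "L2_set (\<lambda>j. Ax P i (?x i) j - b j) {..<m} = 0"
      using residual_bound[OF that(1) orc_in[OF that(1) _ l, of 1]] assms(1)
        L2_set_nonneg[of "\<lambda>j. Ax P i (?x i) j - b j" "{..<m}"] by (auto simp: vnorm_def)
    then show ?thesis
      using that(2) by (simp add: L2_set_eq_0_iff)
  qed
  then have "dot m v (avg_residual P ?x) = 0" for v
    unfolding dot_avg_residual by (simp add: dot_def)
  then have "lagrangian ?x lstar = lagrangian ?x l"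
    by (simp add: lagrangian_def)
  then show ?thesis
    using dual_fun_le_lagrangian[OF lstar_rvec, of ?x] orc_in l dual_fun_eq_lagrangian[OF l] by simp
qed

lemma dual_avg_gap:
  assumes T: "T > 0" and \<Lambda>: "\<Lambda> > 0"
  defines "\<alpha> \<equiv> \<Lambda> / (Gtilde P * sqrt (real T))"
  shows "measure_pmf.expectation (unif_indices N (T - 1)) (\<lambda>s. dstar - dual_fun P (dual_avg P orc \<alpha> T s))
    \<le> Gtilde P * ((vnorm m lstar)\<^sup>2 / \<Lambda> + \<Lambda>) / (2 * sqrt (real T))"
proof (cases "Gtilde P = 0")
  case True
  have "dual_avg P orc \<alpha> T s \<in> rvec m" for s
    using dual_avg_nonneg[of \<alpha> T s] by (auto simp: nonneg_vecs_def)
  then have "dstar - dual_fun P (dual_avg P orc \<alpha> T s) = 0" for s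
    using dstar_le_dual_fun_if_Gtilde_0[OF True] dual_fun_le_dstar[OF dual_avg_nonneg]
    by (metis antisym diff_self)
  then show ?thesis
    using True by simp
next
  case False
  let ?E = "measure_pmf.expectation (unif_indices N (T - 1))"
  have G: "Gtilde P > 0"
    using False Gtilde_nonneg by simp
  have \<alpha>: "\<alpha> > 0"
    using G \<Lambda> T by (simp add: \<alpha>_def)
  have "2 * \<alpha> * real T * (dstar - dual_fun P (dual_avg P orc \<alpha> T s))
      \<le> (dist_lstar (dual_iter P orc \<alpha> T s (T - 1)) + 2 * \<alpha> * (\<Sum>t<T - 1. stage1_gap \<alpha> T s t))
        + \<alpha>\<^sup>2 * (Gtilde P)\<^sup>2" for s
  proof -
    \<comment> \<open>Concavity reduces the gap of the average to the average of the
      \<open>T\<close> gaps. The last of these is split off because only \<open>T - 1\<close>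
      indices are sampled.\<close>
    have "(1 / real T) * (\<Sum>t<T. dual_fun P (dual_iter P orc \<alpha> T s t)) \<le> dual_fun P (dual_avg P orc \<alpha> T s)"
      unfolding dual_avg_def by (intro dual_fun_avg_ge T dual_iter_rvec)
    then have "real T * (dstar - dual_fun P (dual_avg P orc \<alpha> T s)) \<le> (\<Sum>t<T. stage1_gap \<alpha> T s t)"
      using T by (simp add: sum_subtractf field_simps)
    moreover have "{..<T} = insert (T - 1) {..<T - 1}"
      using T by auto
    ultimately have "real T * (dstar - dual_fun P (dual_avg P orc \<alpha> T s))
        \<le> (\<Sum>t<T - 1. stage1_gap \<alpha> T s t) + stage1_gap \<alpha> T s (T - 1)"
      by simp
    from mult_left_mono[OF this, of "2 * \<alpha>"]
    have "2 * \<alpha> * real T * (dstar - dual_fun P (dual_avg P orc \<alpha> T s))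
        \<le> 2 * \<alpha> * (\<Sum>t<T - 1. stage1_gap \<alpha> T s t) + 2 * \<alpha> * stage1_gap \<alpha> T s (T - 1)"
      using \<alpha> by (simp add: algebra_simps)
    moreover have "0 \<le> dist_lstar (dual_iter P orc \<alpha> T s (T - 1))
        - 2 * \<alpha> * stage1_gap \<alpha> T s (T - 1) + \<alpha>\<^sup>2 * (Gtilde P)\<^sup>2"
      by (rule order_trans[OF _ subgradient_step[OF dual_iter_rvec]])
        (use \<alpha> in \<open>auto intro!: mult_nonneg_nonneg divide_nonneg_nonneg sum_nonneg\<close>)
    ultimately show ?thesis
      by linarith
  qed
  then have "?E (\<lambda>s. 2 * \<alpha> * real T * (dstar - dual_fun P (dual_avg P orc \<alpha> T s)))
      \<le> ?E (\<lambda>s. (dist_lstar (dual_iter P orc \<alpha> T s (T - 1)) + 2 * \<alpha> * (\<Sum>t<T - 1. stage1_gap \<alpha> T s t))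
        + \<alpha>\<^sup>2 * (Gtilde P)\<^sup>2)"
    by (intro integral_mono integrable_unif_indices N_pos)
  also have "\<dots> = ?E (\<lambda>s. dist_lstar (dual_iter P orc \<alpha> T s (T - 1)) + 2 * \<alpha> * (\<Sum>t<T - 1. stage1_gap \<alpha> T s t))
        + \<alpha>\<^sup>2 * (Gtilde P)\<^sup>2"
    by (subst Bochner_Integration.integral_add) (simp_all only: integrable_unif_indices N_pos, simp)
  also have "\<dots> \<le> (vnorm m lstar)\<^sup>2 + real (T - 1) * (\<alpha>\<^sup>2 * (Gtilde P)\<^sup>2) + \<alpha>\<^sup>2 * (Gtilde P)\<^sup>2"
    using stage1_potential[of \<alpha> "T - 1" T] \<alpha> T by simp
  also have "\<dots> = (vnorm m lstar)\<^sup>2 + real T * (\<alpha>\<^sup>2 * (Gtilde P)\<^sup>2)"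
    using T by (cases T) (auto simp: algebra_simps)
  \<comment> \<open>This is what the stepsize is tuned for: the accumulated squared steps amount to
    a constant.\<close>
  also have "real T * (\<alpha>\<^sup>2 * (Gtilde P)\<^sup>2) = \<Lambda>\<^sup>2"
    using G T by (simp add: \<alpha>_def power_divide power_mult_distrib)
  finally have le: "2 * \<alpha> * real T * ?E (\<lambda>s. dstar - dual_fun P (dual_avg P orc \<alpha> T s)) \<le> (vnorm m lstar)\<^sup>2 + \<Lambda>\<^sup>2"
    by simp
  have "2 * \<alpha> * real T = 2 * \<Lambda> * sqrt (real T) / Gtilde P"
    using T by (simp add: \<alpha>_def real_div_sqrt divide_simps)
  from le[unfolded this] have "?E (\<lambda>s. dstar - dual_fun P (dual_avg P orc \<alpha> T s))
      \<le> ((vnorm m lstar)\<^sup>2 + \<Lambda>\<^sup>2) / (2 * \<Lambda> * sqrt (real T) / Gtilde P)"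
    using G \<Lambda> T by (subst pos_le_divide_eq) (simp_all only: mult.commute, simp)
  also have "\<dots> = Gtilde P * ((vnorm m lstar)\<^sup>2 / \<Lambda> + \<Lambda>) / (2 * sqrt (real T))"
    using G \<Lambda> T by (simp add: field_simps power2_eq_square)
  finally show ?thesis .
qed

lemma primal_avg_in:
  assumes "i < N"
  shows "primal_avg P orc \<alpha> T s i \<in> Xset P i"
  unfolding primal_avg_def
proof (rule convex_set_average)
  show "convex_set (Xset P i)"
    using problem assms by (auto simp: sep_convex_problem_def)
  show "finite (sampled T s i)"
    by (rule finite_subset[of _ "{..<T - 1}"]) (auto simp: sampled_def)
qed (use assms orc_in dual_iter_rvec in auto)

end

section \<open>Block-coordinate Frank-Wolfe: potential, invariant and one-step decrease\<close>

section \<open>Stage 2\<close>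

text \<open>The quadratic upper bound (descent inequality) for the squared positive part, whose
  derivative at \<open>a\<close> is \<open>2 * max a 0\<close>.\<close>

lemma power2_max_add_le:
  fixes a d :: real
  shows "(max (a + d) 0)\<^sup>2 \<le> (max a 0)\<^sup>2 + 2 * (max a 0 * d) + d\<^sup>2"
proof -
  have "\<bar>max (a + d) 0\<bar> \<le> \<bar>max a 0 + d\<bar>"
    by linarith
  then have "(max (a + d) 0)\<^sup>2 \<le> (max a 0 + d)\<^sup>2"
    by (simp only: abs_le_square_iff)
  then show ?thesis
    by (simp add: power2_eq_square algebra_simps)
qed

lemma sum_fun_upd_lessThan:
  fixes f :: "nat \<Rightarrow> real"
  assumes "i < n"
  shows "(\<Sum>l<n. (f(i := y)) l) = (\<Sum>l<n. f l) + (y - f i)"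
proof -
  have "(\<Sum>l<n. (f(i := y)) l) = y + (\<Sum>l\<in>{..<n} - {i}. f l)"
    using assms by (subst sum.remove[of _ i]) (auto intro!: sum.cong)
  moreover have "(\<Sum>l<n. f l) = f i + (\<Sum>l\<in>{..<n} - {i}. f l)"
    using assms by (subst sum.remove[of _ i]) auto
  ultimately show ?thesis by simp
qed

context strongly_dual_problem
begin

definition fw_gamma :: "real \<Rightarrow> fw_state \<Rightarrow> real" where
  "fw_gamma dv = (\<lambda>(x, \<beta>, z). max ((\<Sum>l<N. \<beta> l) - dv) 0)"

definition fw_dir :: "fw_state \<Rightarrow> vect" where
  "fw_dir = (\<lambda>(x, \<beta>, z). pos_part (\<lambda>j. (\<Sum>l<N. z l j) - b j))"

text \<open>As a function of the block sums of \<open>\<beta>\<close> and \<open>z\<close>, its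
  gradient is twice the pair of \<open>fw_gamma\<close> and \<open>fw_dir\<close>. The oracle call
  with these weights is thus the linear minimization of Frank-Wolfe.\<close>

definition fw_potential :: "real \<Rightarrow> fw_state \<Rightarrow> real" where
  "fw_potential dv st = (fw_gamma dv st)\<^sup>2 + (\<Sum>j<m. (fw_dir st j)\<^sup>2)"

text \<open>Linearity keeps \<open>z\<close> exact, while convexity makes \<open>\<beta>\<close>
  only an upper bound for the objective at the averaged block. Membership of the rescaled pair in
  the hull brings the diameter of \<open>Cset\<close> into the curvature term.\<close>

definition fw_inv :: "fw_state \<Rightarrow> bool" where
  "fw_inv = (\<lambda>(x, \<beta>, z). \<forall>i<N. x i \<in> Xset P i \<and> hval P i (x i) \<le> real N * \<beta> i \<and>
     (\<forall>j. real N * z i j = Ax P i (x i) j) \<and>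
     case_nat (real N * \<beta> i) (\<lambda>j. real N * z i j) \<in> convex_set hull Cset P i)"

lemma fw_inv_init:
  assumes "\<And>i. i < N \<Longrightarrow> x i \<in> Xset P i"
  shows "fw_inv (fw_init P x)"
  using N_pos assms by (auto simp: fw_inv_def fw_init_def Cset_def intro!: hull_inc)

lemma fw_gamma_nonneg: "fw_gamma dv st \<ge> 0"
  by (auto simp: fw_gamma_def split: prod.splits)

lemma fw_dir_rvec: "fw_inv st \<Longrightarrow> fw_dir st \<in> rvec m"
proof (cases st)
  fix x \<beta> z assume inv: "fw_inv st" and st: "st = (x, \<beta>, z)"
  have "z l j = 0" if "l < N" "j \<ge> m" for l j
  proof -
    have "real N * z l j = 0"
      using inv that by (auto simp: st fw_inv_def Ax_outside)
    then show ?thesis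
      using N_pos by simp
  qed
  then show ?thesis
    using rhs_rvec by (auto simp: st fw_dir_def pos_part_def topspace_Euclidean_space)
qed

lemma fw_step_eq:
  fixes dv :: real and x :: "nat \<Rightarrow> vect" and \<beta> :: "nat \<Rightarrow> real" and z :: "nat \<Rightarrow> vect"
  defines "y \<equiv> \<lambda>i. orc i (fw_gamma dv (x, \<beta>, z)) (fw_dir (x, \<beta>, z))"
  shows "fw_step P orc dv \<rho> i (x, \<beta>, z) = (x(i := seg \<rho> (x i) (y i)),
         \<beta>(i := (1 - \<rho>) * \<beta> i + \<rho> / real N * hval P i (y i)),
         z(i := (\<lambda>j. (1 - \<rho>) * z i j + \<rho> / real N * Ax P i (y i) j)))"
  by (simp add: fw_step_def Let_def y_def fw_gamma_def fw_dir_def)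

lemma fw_inv_step:
  assumes inv: "fw_inv st" and \<rho>: "0 \<le> \<rho>" "\<rho> \<le> 1"
  shows "fw_inv (fw_step P orc dv \<rho> i st)"
proof (cases st)
  fix x \<beta> z assume st: "st = (x, \<beta>, z)"
  define y where "y = orc i (fw_gamma dv st) (fw_dir st)"
  show ?thesis
  \<comment> \<open>An index beyond the blocks touches nothing that the invariant mentions. Hence it
    holds for every index function, not only for those of positive probability.\<close>
  proof (cases "i < N")
    case False
    then show ?thesis
      using inv unfolding st fw_step_eq fw_inv_def by auto
  next
    case True
    have y: "y \<in> Xset P i"
      unfolding y_def by (intro orc_in True fw_gamma_nonneg fw_dir_rvec inv)
    have x: "x i \<in> Xset P i" and \<beta>: "hval P i (x i) \<le> real N * \<beta> i"
      and z: "\<And>j. real N * z i j = Ax P i (x i) j"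
      and hull: "case_nat (real N * \<beta> i) (\<lambda>j. real N * z i j) \<in> convex_set hull Cset P i"
      using inv True by (auto simp: st fw_inv_def)
    let ?\<beta> = "(1 - \<rho>) * \<beta> i + \<rho> / real N * hval P i y"
    let ?z = "\<lambda>j. (1 - \<rho>) * z i j + \<rho> / real N * Ax P i y j"
    have N\<beta>: "real N * ?\<beta> = (1 - \<rho>) * (real N * \<beta> i) + \<rho> * hval P i y"
      and Nz: "\<And>j. real N * ?z j = (1 - \<rho>) * (real N * z i j) + \<rho> * Ax P i y j"
      using N_pos by (simp_all add: field_simps)
    have "hval P i (seg \<rho> (x i) y) \<le> (1 - \<rho>) * hval P i (x i) + \<rho> * hval P i y"
      by (rule hval_seg_le[OF True x y \<rho>])
    also have "\<dots> \<le> (1 - \<rho>) * (real N * \<beta> i) + \<rho> * hval P i y"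
      using \<beta> \<rho> by (intro add_right_mono mult_left_mono) auto
    finally have 1: "hval P i (seg \<rho> (x i) y) \<le> real N * ?\<beta>"
      by (simp only: N\<beta>)
    have 2: "real N * ?z j = Ax P i (seg \<rho> (x i) y) j" for j
      unfolding Nz Ax_seg z ..
    have "seg \<rho> (case_nat (real N * \<beta> i) (\<lambda>j. real N * z i j)) (case_nat (hval P i y) (Ax P i y))
        \<in> convex_set hull Cset P i"
      using convex_set_hull[of "Cset P i"] hull hull_inc[of "case_nat (hval P i y) (Ax P i y)" "Cset P i" convex_set] y \<rho>
      by (auto simp: convex_set_def Cset_def)
    also have "seg \<rho> (case_nat (real N * \<beta> i) (\<lambda>j. real N * z i j)) (case_nat (hval P i y) (Ax P i y))
        = case_nat (real N * ?\<beta>) (\<lambda>j. real N * ?z j)"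
      unfolding N\<beta> Nz by (rule ext) (simp add: seg_def split: nat.split)
    finally have 3: "case_nat (real N * ?\<beta>) (\<lambda>j. real N * ?z j) \<in> convex_set hull Cset P i" .
    show ?thesis
      using inv Xset_seg[OF True x y \<rho>] 1 2 3
      unfolding st fw_step_eq y_def[symmetric, unfolded st] fw_inv_def by auto
  qed
qed

text \<open>A feasible primal point of value at most \<open>dstar + \<delta>\<close> is a competitor for all blocks at
  once; only the infimum of the primal problem is used, not a primal minimizer.\<close>

lemma fw_linear_minimum_le:
  assumes \<gamma>: "\<gamma> \<ge> 0" and g: "g \<in> nonneg_vecs m"
  shows "(1 / real N) * (\<Sum>i<N. \<gamma> * hval P i (orc i \<gamma> g) + dot m g (Ax P i (orc i \<gamma> g)))
    \<le> \<gamma> * dstar + dot m g b"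
proof -
  let ?lhs = "(1 / real N) * (\<Sum>i<N. \<gamma> * hval P i (orc i \<gamma> g) + dot m g (Ax P i (orc i \<gamma> g)))"
  have bound: "?lhs \<le> \<gamma> * dstar + dot m g b + \<gamma> * \<delta>" if "\<delta> > 0" for \<delta>
  proof -
    have "primal_value P < ereal (dstar + \<delta>)"
      using that by (simp add: strong_duality[symmetric])
    then obtain x where x: "x \<in> feasible_set P" and "ereal (avg_obj P x) < ereal (dstar + \<delta>)"
      unfolding primal_value_def INF_less_iff by blast
    then have obj: "avg_obj P x \<le> dstar + \<delta>"
      by simp
    have "?lhs \<le> (1 / real N) * (\<Sum>i<N. \<gamma> * hval P i (x i) + dot m g (Ax P i (x i)))"
      using x g \<gamma> by (intro mult_left_mono sum_mono orc_le) (auto simp: feasible_set_def nonneg_vecs_def)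
    also have "\<dots> = \<gamma> * avg_obj P x + dot m g (\<lambda>j. (1 / real N) * (\<Sum>i<N. Ax P i (x i) j))"
      unfolding sum.distrib dot_def avg_obj_def
      by (subst sum.swap) (simp add: sum_distrib_left algebra_simps sum_divide_distrib)
    also have "\<dots> \<le> \<gamma> * (dstar + \<delta>) + dot m g b"
      using x g \<gamma> obj unfolding dot_def
      by (intro add_mono mult_left_mono sum_mono) (auto simp: feasible_set_def nonneg_vecs_def)
    finally show ?thesis
      by (simp add: algebra_simps)
  qed
  show ?thesis
  proof (rule field_le_epsilon)
    fix e :: real assume e: "e > 0"
    \<comment> \<open>The summand 1 keeps the divisor positive when \<open>\<gamma>\<close> is
      0.\<close>
    have "\<gamma> * (e / (\<gamma> + 1)) \<le> e"
      using e \<gamma> by (simp add: field_simps)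
    then show "?lhs \<le> \<gamma> * dstar + dot m g b + e"
      using bound[of "e / (\<gamma> + 1)"] e \<gamma> by simp
  qed
qed

text \<open>The descent inequality in each coordinate: the cross terms form the Frank-Wolfe gap of
  block \<open>i\<close>, and the squares form a squared distance between two points of the hull of
  \<open>Cset P i\<close>, scaled by 1/N.\<close>

lemma fw_potential_step:
  fixes dv :: real
  assumes inv: "fw_inv st" and i: "i < N"
  defines "y \<equiv> orc i (fw_gamma dv st) (fw_dir st)"
  shows "fw_potential dv (fw_step P orc dv \<rho> i st) \<le> fw_potential dv st
      + 2 * \<rho> * (fw_gamma dv st * (hval P i y / real N - fst (snd st) i)
          + dot m (fw_dir st) (\<lambda>j. Ax P i y j / real N - snd (snd st) i j))
      + (\<rho> / real N)\<^sup>2 * (diam (Suc m) (convex_set hull Cset P i))\<^sup>2"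
proof (cases st)
  fix x \<beta> z assume st: "st = (x, \<beta>, z)"
  define e where "e = hval P i y / real N - \<beta> i"
  define w where "w = (\<lambda>j. Ax P i y j / real N - z i j)"
  define st' where "st' = fw_step P orc dv \<rho> i st"
  have y: "y \<in> Xset P i"
    unfolding y_def by (intro orc_in i fw_gamma_nonneg fw_dir_rvec inv)
  have "fw_gamma dv st' = max ((\<Sum>l<N. \<beta> l) - dv + \<rho> * e) 0"
    unfolding st'_def st fw_step_eq y_def[symmetric, unfolded st]
    by (simp add: fw_gamma_def sum_fun_upd_lessThan[OF i] e_def algebra_simps del: fun_upd_apply)
  then have 1: "(fw_gamma dv st')\<^sup>2 \<le> (fw_gamma dv st)\<^sup>2 + 2 * (fw_gamma dv st * (\<rho> * e)) + (\<rho> * e)\<^sup>2"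
    using power2_max_add_le[of "(\<Sum>l<N. \<beta> l) - dv" "\<rho> * e"] by (simp add: st fw_gamma_def)
  have 2: "(fw_dir st' j)\<^sup>2 \<le> (fw_dir st j)\<^sup>2 + 2 * (fw_dir st j * (\<rho> * w j)) + (\<rho> * w j)\<^sup>2" for j
  proof -
    have "(\<Sum>l<N. (z(i := \<lambda>j. (1 - \<rho>) * z i j + \<rho> / real N * Ax P i y j)) l j)
        = (\<Sum>l<N. ((\<lambda>l. z l j)(i := (1 - \<rho>) * z i j + \<rho> / real N * Ax P i y j)) l)"
      by (intro sum.cong) auto
    also have "\<dots> = (\<Sum>l<N. z l j) + \<rho> * w j"
      unfolding sum_fun_upd_lessThan[OF i] by (simp add: w_def algebra_simps)
    finally have "fw_dir st' j = max ((\<Sum>l<N. z l j) - b j + \<rho> * w j) 0"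
      unfolding st'_def st fw_step_eq y_def[symmetric, unfolded st]
      by (simp add: fw_dir_def pos_part_def algebra_simps del: fun_upd_apply)
    then show ?thesis
      using power2_max_add_le[of "(\<Sum>l<N. z l j) - b j" "\<rho> * w j"] by (simp add: st fw_dir_def pos_part_def)
  qed
  have "fw_potential dv st' \<le> ((fw_gamma dv st)\<^sup>2 + 2 * (fw_gamma dv st * (\<rho> * e)) + (\<rho> * e)\<^sup>2)
      + (\<Sum>j<m. (fw_dir st j)\<^sup>2 + 2 * (fw_dir st j * (\<rho> * w j)) + (\<rho> * w j)\<^sup>2)"
    unfolding fw_potential_def by (intro add_mono sum_mono 1 2)
  also have "\<dots> = fw_potential dv st + 2 * \<rho> * (fw_gamma dv st * e + dot m (fw_dir st) w)
      + \<rho>\<^sup>2 * (e\<^sup>2 + (\<Sum>j<m. (w j)\<^sup>2))"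
    by (simp add: fw_potential_def dot_def sum.distrib sum_distrib_left power_mult_distrib algebra_simps)
  also have "\<dots> \<le> fw_potential dv st + 2 * \<rho> * (fw_gamma dv st * e + dot m (fw_dir st) w)
      + \<rho>\<^sup>2 * ((diam (Suc m) (convex_set hull Cset P i))\<^sup>2 / (real N)\<^sup>2)"
  proof -
    let ?p = "case_nat (hval P i y) (Ax P i y)"
    let ?q = "case_nat (real N * \<beta> i) (\<lambda>j. real N * z i j)"
    have p: "?p \<in> convex_set hull Cset P i"
      using y by (intro hull_inc) (auto simp: Cset_def)
    have q: "?q \<in> convex_set hull Cset P i"
      using inv i by (auto simp: st fw_inv_def)
    have pq: "?p j - ?q j = real N * case_nat e w j" for j
      using N_pos by (cases j) (auto simp: e_def w_def field_simps)
    have "(real N)\<^sup>2 * (e\<^sup>2 + (\<Sum>j<m. (w j)\<^sup>2)) = (vnorm (Suc m) (\<lambda>j. ?p j - ?q j))\<^sup>2"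
      unfolding pq vnorm_def L2_set_def
      by (simp add: sum_nonneg sum.lessThan_Suc_shift power_mult_distrib sum_distrib_left algebra_simps del: sum.lessThan_Suc)
    also have "\<dots> \<le> (diam (Suc m) (convex_set hull Cset P i))\<^sup>2"
      using Cset_hull_diff[OF i p q] by (intro power_mono) (auto simp: vnorm_def)
    finally have "e\<^sup>2 + (\<Sum>j<m. (w j)\<^sup>2) \<le> (diam (Suc m) (convex_set hull Cset P i))\<^sup>2 / (real N)\<^sup>2"
      using N_pos by (simp add: field_simps)
    then show ?thesis
      by (intro add_left_mono mult_left_mono) auto
  qed
  finally show ?thesis
    by (simp add: st'_def e_def w_def st power_divide)
qed

lemma average_affine:
  "(1 / real N) * (\<Sum>i<N. c + p * f i + q * h i) = c + p / real N * (\<Sum>i<N. f i) + q * ((1 / real N) * (\<Sum>i<N. h i))"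
  using N_pos by (simp add: sum.distrib sum_distrib_left[symmetric] add_divide_distrib)

lemma Dconst_square:
  "(Dconst P)\<^sup>2 = (1 / real N) * (\<Sum>i<N. (diam (Suc m) (convex_set hull Cset P i))\<^sup>2)"
  unfolding Dconst_def by (simp add: sum_nonneg)

text \<open>Averaging over the sampled block adds the block gaps to one linear minimization over all
  blocks, which \<open>fw_linear_minimum_le\<close> compares with nearly optimal feasible points.
  The squared diameters average to \<open>(Dconst P)\<^sup>2\<close>.\<close>

lemma fw_potential_average:
  assumes inv: "fw_inv st" and \<rho>: "\<rho> \<ge> 0" and \<gamma>: "dv \<le> dstar"
  shows "(1 / real N) * (\<Sum>i<N. fw_potential dv (fw_step P orc dv \<rho> i st))
    \<le> fw_potential dv st + 2 * (\<rho> / real N) * (fw_gamma dv st * (dstar - dv) - fw_potential dv st)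
      + (\<rho> / real N)\<^sup>2 * (Dconst P)\<^sup>2"
proof (cases st)
  fix x \<beta> z assume st: "st = (x, \<beta>, z)"
  define ga where "ga = fw_gamma dv st"
  define g where "g = fw_dir st"
  define y where "y = (\<lambda>i. orc i ga g)"
  let ?dm = "\<lambda>i. (diam (Suc m) (convex_set hull Cset P i))\<^sup>2"
  have g: "g \<in> nonneg_vecs m"
    using fw_dir_rvec[OF inv] by (auto simp: g_def nonneg_vecs_def fw_dir_def st pos_part_def)
  have "(\<Sum>i<N. ga * (hval P i (y i) / real N - \<beta> i) + dot m g (\<lambda>j. Ax P i (y i) j / real N - z i j))
      = (1 / real N) * (\<Sum>i<N. ga * hval P i (y i) + dot m g (Ax P i (y i)))
        - (ga * (\<Sum>i<N. \<beta> i) + dot m g (\<lambda>j. \<Sum>i<N. z i j))"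
  proof -
    have e1: "dot m g (\<lambda>j. \<Sum>i<N. z i j) = (\<Sum>i<N. dot m g (z i))"
      unfolding dot_def by (subst sum.swap) (simp add: sum_distrib_left)
    have e2: "dot m g (\<lambda>j. Ax P i (y i) j / real N - z i j) = dot m g (Ax P i (y i)) / real N - dot m g (z i)" for i
      by (simp add: dot_def sum_subtractf sum_divide_distrib algebra_simps)
    show ?thesis
      unfolding e1 e2
      by (simp add: sum.distrib sum_subtractf sum_distrib_left sum_divide_distrib add_divide_distrib algebra_simps)
  qed
  also have "\<dots> \<le> ga * dstar + dot m g b - (ga * (\<Sum>i<N. \<beta> i) + dot m g (\<lambda>j. \<Sum>i<N. z i j))"
    using fw_linear_minimum_le[of ga g] g fw_gamma_nonneg by (simp add: ga_def y_def)
  also have "\<dots> = ga * (dstar - dv) - fw_potential dv st"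
  proof -
    \<comment> \<open>A number times its positive part is the square of that part. So pairing the
      weights with the shifted block sums returns the whole potential, twice what convexity alone
      gives; shifting by \<open>dv\<close> instead of \<open>dstar\<close> leaves the dual gap
      term.\<close>
    have "ga * ((\<Sum>i<N. \<beta> i) - dv) = ga\<^sup>2"
      by (auto simp: ga_def fw_gamma_def st power2_eq_square max_def)
    moreover have "dot m g (\<lambda>j. (\<Sum>i<N. z i j) - b j) = (\<Sum>j<m. (g j)\<^sup>2)"
      unfolding dot_def by (intro sum.cong) (auto simp: g_def fw_dir_def st pos_part_def power2_eq_square max_def)
    moreover have "dot m g (\<lambda>j. (\<Sum>i<N. z i j) - b j) = dot m g (\<lambda>j. \<Sum>i<N. z i j) - dot m g b"
      by (simp add: dot_def sum_subtractf algebra_simps)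
    ultimately show ?thesis
      by (simp add: fw_potential_def ga_def[symmetric] g_def[symmetric] algebra_simps)
  qed
  finally have lin: "(\<Sum>i<N. ga * (hval P i (y i) / real N - \<beta> i) + dot m g (\<lambda>j. Ax P i (y i) j / real N - z i j))
      \<le> ga * (dstar - dv) - fw_potential dv st" .
  have "(1 / real N) * (\<Sum>i<N. fw_potential dv (fw_step P orc dv \<rho> i st))
      \<le> (1 / real N) * (\<Sum>i<N. fw_potential dv st
        + 2 * \<rho> * (ga * (hval P i (y i) / real N - \<beta> i) + dot m g (\<lambda>j. Ax P i (y i) j / real N - z i j))
        + (\<rho> / real N)\<^sup>2 * ?dm i)"
    using fw_potential_step[OF inv, of _ dv \<rho>]
    by (intro mult_left_mono sum_mono) (auto simp: ga_def g_def y_def st)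
  also have "\<dots> = fw_potential dv st + 2 * (\<rho> / real N) *
        (\<Sum>i<N. ga * (hval P i (y i) / real N - \<beta> i) + dot m g (\<lambda>j. Ax P i (y i) j / real N - z i j))
      + (\<rho> / real N)\<^sup>2 * (Dconst P)\<^sup>2"
    unfolding Dconst_square average_affine by simp
  also have "\<dots> \<le> fw_potential dv st + 2 * (\<rho> / real N) * (ga * (dstar - dv) - fw_potential dv st)
      + (\<rho> / real N)\<^sup>2 * (Dconst P)\<^sup>2"
    using lin \<rho> by (intro add_right_mono add_left_mono mult_left_mono) auto
  finally show ?thesis
    by (simp add: ga_def)
qed

end

section \<open>Solving the Frank-Wolfe recursion\<close>

lemma fw_rate_step:
  fixes n :: real
  assumes n: "n \<ge> 2" and e: "0 \<le> e" "e \<le> (c / n) ^ 3 * e0 + 2 * a + 4 * d / n"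
    and nonneg: "c \<ge> 0" "e0 \<ge> 0" "a \<ge> 0" "d \<ge> 0"
  shows "(1 - 3 / n) * e + 4 * a / n + 4 * d / n\<^sup>2 \<le> (c / (n + 1)) ^ 3 * e0 + 2 * a + 4 * d / (n + 1)"
proof (cases "n \<ge> 3")
  case True
  \<comment> \<open>This identity shows that the factor \<open>1 - 3 / n\<close> carries the cubic
    decay from \<open>n\<close> to \<open>n + 1\<close>.\<close>
  have "(n - 3) * (n + 1) ^ 3 + (6 * n\<^sup>2 + 8 * n + 3) = n ^ 4"
    by (simp add: power4_eq_xxxx power3_eq_cube power2_eq_square algebra_simps)
  moreover have "6 * n\<^sup>2 + 8 * n + 3 \<ge> 0"
    using n by (intro add_nonneg_nonneg) auto
  ultimately have "(n - 3) * (n + 1) ^ 3 \<le> n ^ 4"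
    by linarith
  then have "(1 - 3 / n) * (1 / n ^ 3) \<le> 1 / (n + 1) ^ 3"
    using n by (simp add: divide_simps power4_eq_xxxx power3_eq_cube mult.assoc)
  from mult_left_mono[OF this, of "c ^ 3 * e0"]
  have 1: "(1 - 3 / n) * ((c / n) ^ 3 * e0) \<le> (c / (n + 1)) ^ 3 * e0"
    using nonneg by (simp add: power_divide mult_ac)
  have 2: "(1 - 3 / n) * (2 * a) + 4 * a / n \<le> 2 * a"
    using n nonneg by (simp add: field_simps)
  have "(1 - 3 / n) * (1 / n) + 1 / n\<^sup>2 \<le> 1 / (n + 1)"
    using n by (simp add: divide_simps power2_eq_square) (simp add: algebra_simps)
  from mult_left_mono[OF this, of "4 * d"]
  have "4 * d * ((1 - 3 / n) * (1 / n) + 1 / n\<^sup>2) \<le> 4 * d / (n + 1)"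
    using nonneg by simp
  moreover have "4 * d * ((1 - 3 / n) * (1 / n) + 1 / n\<^sup>2) = (1 - 3 / n) * (4 * d / n) + 4 * d / n\<^sup>2"
    using n by (simp add: field_simps power2_eq_square)
  ultimately have 3: "(1 - 3 / n) * (4 * d / n) + 4 * d / n\<^sup>2 \<le> 4 * d / (n + 1)"
    by simp
  have "(1 - 3 / n) * e \<le> (1 - 3 / n) * ((c / n) ^ 3 * e0 + 2 * a + 4 * d / n)"
    using True e by (intro mult_left_mono) auto
  then show ?thesis
    using 1 2 3 by (simp add: distrib_left)
next
  case False
  \<comment> \<open>Here the factor is negative, so the bound on \<open>e\<close> cannot be
    inserted; \<open>e\<close> is dropped and the inhomogeneous terms suffice. For
    \<open>n = k + 2 N\<close> this concerns only the first step with a single block.\<close>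
  have "(1 - 3 / n) * e \<le> 0"
    using n e False by (intro mult_nonpos_nonneg) (auto simp: field_simps)
  moreover have "4 * a / n \<le> 2 * a"
    using n nonneg mult_right_mono[of 2 n a] by (simp add: field_simps)
  moreover have "n + 1 \<le> n\<^sup>2"
    unfolding power2_eq_square using n mult_right_mono[of 2 n n] by linarith
  then have "4 * d / n\<^sup>2 \<le> 4 * d / (n + 1)"
    using n nonneg by (intro divide_left_mono) auto
  moreover have "(c / (n + 1)) ^ 3 * e0 \<ge> 0"
    using n nonneg by simp
  ultimately show ?thesis by linarith
qed

context strongly_dual_problem
begin

lemma fw_iter_upd: "k \<le> n \<Longrightarrow> fw_iter P orc dv x0 (r(n := i)) k = fw_iter P orc dv x0 r k"
  by (induction k) auto

lemma fw_inv_iter: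
  assumes "\<And>i. i < N \<Longrightarrow> x0 i \<in> Xset P i"
  shows "fw_inv (fw_iter P orc dv x0 r k)"
proof (induction k)
  case 0
  then show ?case using fw_inv_init[OF assms] by simp
next
  case (Suc k)
  then show ?case
    using N_pos by (auto intro!: fw_inv_step)
qed

lemma fw_potential_nonneg: "fw_potential dv st \<ge> 0"
  by (simp add: fw_potential_def sum_nonneg)

lemma fw_rate:
  assumes x0: "\<And>i. i < N \<Longrightarrow> x0 i \<in> Xset P i" and dv: "dv \<le> dstar"
  shows "measure_pmf.expectation (unif_indices N k) (\<lambda>r. fw_potential dv (fw_iter P orc dv x0 r k))
    \<le> (2 * real N / (real k + 2 * real N)) ^ 3 * fw_potential dv (fw_init P x0)
      + 2 * (dstar - dv)\<^sup>2 + 4 * (Dconst P)\<^sup>2 / (real k + 2 * real N)"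
proof (induction k)
  case 0
  then show ?case
    using N_pos by (simp add: expectation_unif_indices_0)
next
  case (Suc k)
  let ?n = "real k + 2 * real N"
  let ?\<rho> = "2 * real N / ?n"
  let ?E = "measure_pmf.expectation (unif_indices N k)"
  let ?\<phi> = "\<lambda>r. fw_potential dv (fw_iter P orc dv x0 r k)"
  have n: "?n \<ge> 2"
    using N_pos by simp
  have step: "(1 / real N) * (\<Sum>i<N. fw_potential dv (fw_iter P orc dv x0 (r(k := i)) (Suc k)))
      \<le> (1 - 3 / ?n) * ?\<phi> r + (4 * (dstar - dv)\<^sup>2 / ?n + 4 * (Dconst P)\<^sup>2 / ?n\<^sup>2)" for r
  proof -
    define st where "st = fw_iter P orc dv x0 r k"
    let ?\<gamma> = "fw_gamma dv st"
    have "(1 / real N) * (\<Sum>i<N. fw_potential dv (fw_iter P orc dv x0 (r(k := i)) (Suc k)))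
        = (1 / real N) * (\<Sum>i<N. fw_potential dv (fw_step P orc dv ?\<rho> i st))"
      by (simp add: fw_iter_upd st_def fun_upd_same del: fun_upd_apply)
    also have "\<dots> \<le> fw_potential dv st + 2 * (?\<rho> / real N) * (?\<gamma> * (dstar - dv) - fw_potential dv st)
      + (?\<rho> / real N)\<^sup>2 * (Dconst P)\<^sup>2"
      unfolding st_def by (intro fw_potential_average fw_inv_iter x0 dv) auto
    also have "?\<rho> / real N = 2 / ?n"
      using N_pos by simp
    also have "fw_potential dv st + 2 * (2 / ?n) * (?\<gamma> * (dstar - dv) - fw_potential dv st)
        + (2 / ?n)\<^sup>2 * (Dconst P)\<^sup>2
        \<le> fw_potential dv st + 2 * (2 / ?n) * (fw_potential dv st / 4 + (dstar - dv)\<^sup>2 - fw_potential dv st)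
        + (2 / ?n)\<^sup>2 * (Dconst P)\<^sup>2"
    proof -
      \<comment> \<open>Young's inequality with weight 1/4: it costs 1/n of the contraction 4/n and
        leaves 3/n, the source of the cubic decay.\<close>
      have "0 \<le> (?\<gamma> / 2 - (dstar - dv))\<^sup>2"
        by simp
      then have "?\<gamma> * (dstar - dv) \<le> ?\<gamma>\<^sup>2 / 4 + (dstar - dv)\<^sup>2"
        by (simp add: power2_eq_square algebra_simps)
      moreover have "?\<gamma>\<^sup>2 \<le> fw_potential dv st"
        by (simp add: fw_potential_def sum_nonneg)
      ultimately show ?thesis
        using n by (intro add_right_mono add_left_mono mult_left_mono) auto
    qed
    also have "\<dots> = (1 - 3 / ?n) * fw_potential dv st + (4 * (dstar - dv)\<^sup>2 / ?n + 4 * (Dconst P)\<^sup>2 / ?n\<^sup>2)"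
      by (simp add: algebra_simps power_divide)
    finally show ?thesis
      unfolding st_def .
  qed
  have "measure_pmf.expectation (unif_indices N (Suc k)) (\<lambda>r. fw_potential dv (fw_iter P orc dv x0 r (Suc k)))
      \<le> ?E (\<lambda>r. (1 - 3 / ?n) * ?\<phi> r + (4 * (dstar - dv)\<^sup>2 / ?n + 4 * (Dconst P)\<^sup>2 / ?n\<^sup>2))"
    unfolding expectation_unif_indices_Suc[OF N_pos]
    by (intro integral_mono integrable_unif_indices N_pos step)
  also have "\<dots> = (1 - 3 / ?n) * ?E ?\<phi> + (4 * (dstar - dv)\<^sup>2 / ?n + 4 * (Dconst P)\<^sup>2 / ?n\<^sup>2)"
    by (subst Bochner_Integration.integral_add) (simp_all only: integrable_unif_indices N_pos, simp)
  also have "\<dots> = (1 - 3 / ?n) * ?E ?\<phi> + 4 * (dstar - dv)\<^sup>2 / ?n + 4 * (Dconst P)\<^sup>2 / ?n\<^sup>2"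
    by simp
  also have "\<dots> \<le> (2 * real N / (?n + 1)) ^ 3 * fw_potential dv (fw_init P x0)
      + 2 * (dstar - dv)\<^sup>2 + 4 * (Dconst P)\<^sup>2 / (?n + 1)"
    by (rule fw_rate_step[OF n _ Suc.IH])
      (auto intro!: Bochner_Integration.integral_nonneg fw_potential_nonneg)
  finally show ?case
    by (simp add: algebra_simps)
qed

section \<open>A priori bounds at the start of stage 2 and errors of its output\<close>

lemma avg_residual_bound:
  assumes "\<And>i. i < N \<Longrightarrow> x i \<in> Xset P i"
  shows "vnorm m (avg_residual P x) \<le> Gtilde P"
proof -
  let ?v = "avg_residual P x"
  \<comment> \<open>Cauchy-Schwarz against the averaged residual itself: its squared norm is the
    mean of these products, so one factor of its norm cancels.\<close>
  have cs: "dot m ?v (\<lambda>j. Ax P i (x i) j - b j) \<le> vnorm m ?v * Gtilde P" if "i < N" for i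
  proof -
    have "dot m ?v (\<lambda>j. Ax P i (x i) j - b j) \<le> (\<Sum>j<m. \<bar>?v j\<bar> * \<bar>Ax P i (x i) j - b j\<bar>)"
      unfolding dot_def by (intro sum_mono) (metis abs_ge_self abs_mult)
    also have "\<dots> \<le> vnorm m ?v * vnorm m (\<lambda>j. Ax P i (x i) j - b j)"
      unfolding vnorm_def by (rule L2_set_mult_ineq)
    also have "\<dots> \<le> vnorm m ?v * Gtilde P"
      using residual_bound[OF that assms[OF that]] by (intro mult_left_mono) (auto simp: vnorm_def)
    finally show ?thesis .
  qed
  have "(vnorm m ?v)\<^sup>2 = dot m ?v ?v"
    by (simp add: vnorm_def L2_set_def dot_def sum_nonneg power2_eq_square)
  also have "\<dots> \<le> (1 / real N) * (\<Sum>i<N. vnorm m ?v * Gtilde P)"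
    unfolding dot_avg_residual using cs by (intro mult_left_mono sum_mono) auto
  also have "\<dots> = vnorm m ?v * Gtilde P"
    using N_pos by simp
  finally have "vnorm m ?v * vnorm m ?v \<le> vnorm m ?v * Gtilde P"
    by (simp add: power2_eq_square)
  moreover have "vnorm m ?v \<ge> 0"
    by (simp add: vnorm_def)
  ultimately show ?thesis
    using Gtilde_nonneg by (cases "vnorm m ?v = 0") auto
qed

lemma avg_obj_bound:
  assumes "\<And>i. i < N \<Longrightarrow> x i \<in> Xset P i"
  shows "\<bar>avg_obj P x\<bar> \<le> Hsup P"
proof -
  have "\<bar>avg_obj P x\<bar> \<le> (1 / real N) * (\<Sum>i<N. \<bar>hval P i (x i)\<bar>)"
    by (simp add: avg_obj_def divide_right_mono)
  also have "\<dots> \<le> (1 / real N) * (\<Sum>i<N. Hsup P)"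
    using hval_bound assms by (intro mult_left_mono sum_mono) auto
  finally show ?thesis
    using N_pos by simp
qed

text \<open>At the multiplier 0 the dual value is an average objective value, hence at least
  \<open>- Hsup P\<close>.\<close>

lemma dstar_ge: "dstar \<ge> - Hsup P"
proof -
  have 0: "(\<lambda>_. 0) \<in> nonneg_vecs m" "(\<lambda>_. 0) \<in> rvec m"
    by (auto simp: nonneg_vecs_def topspace_Euclidean_space)
  have "dual_fun P (\<lambda>_. 0) = avg_obj P (\<lambda>i. orc i 1 (\<lambda>_. 0))"
    using dual_fun_eq_lagrangian[OF 0(2)] by (simp add: lagrangian_def dot_def)
  also have "\<dots> \<ge> - Hsup P"
    using avg_obj_bound[of "\<lambda>i. orc i 1 (\<lambda>_. 0)"] orc_in 0(2) by fastforce
  finally show ?thesis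
    using dual_fun_le_dstar[OF 0(1)] by linarith
qed

text \<open>The objective is at most \<open>Hsup P\<close>, and \<open>dv\<close> lies
  \<open>dstar - dv\<close> below \<open>dstar\<close>, which is at least \<open>- Hsup P\<close>.
  Membership of the starting blocks in their domains is enough.\<close>

lemma fw_potential_init_le:
  assumes x0: "\<And>i. i < N \<Longrightarrow> x0 i \<in> Xset P i" and dv: "dv \<le> dstar"
  shows "fw_potential dv (fw_init P x0) \<le> (2 * Hsup P + Gtilde P + (dstar - dv))\<^sup>2"
proof -
  let ?a = "2 * Hsup P + (dstar - dv)"
  have a: "?a \<ge> 0"
    using Hsup_nonneg dv by simp
  have "fw_gamma dv (fw_init P x0) = max (avg_obj P x0 - dv) 0"
    by (simp add: fw_gamma_def fw_init_def avg_obj_def sum_distrib_left)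
  then have "fw_gamma dv (fw_init P x0) \<le> ?a"
    using avg_obj_bound[of x0] x0 dstar_ge a by auto
  then have 1: "(fw_gamma dv (fw_init P x0))\<^sup>2 \<le> ?a\<^sup>2"
    by (intro power_mono fw_gamma_nonneg)
  have "(\<Sum>j<m. (fw_dir (fw_init P x0) j)\<^sup>2) \<le> (\<Sum>j<m. (avg_residual P x0 j)\<^sup>2)"
    by (intro sum_mono) (auto simp: fw_dir_def fw_init_def pos_part_def avg_residual_def sum_distrib_left max_def)
  also have "\<dots> = (vnorm m (avg_residual P x0))\<^sup>2"
    by (simp add: vnorm_def L2_set_def sum_nonneg)
  also have "\<dots> \<le> (Gtilde P)\<^sup>2"
    using avg_residual_bound[of x0] x0 by (intro power_mono) (auto simp: vnorm_def)
  finally have "fw_potential dv (fw_init P x0) \<le> ?a\<^sup>2 + (Gtilde P)\<^sup>2"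
    unfolding fw_potential_def using 1 by linarith
  also have "\<dots> \<le> (?a + Gtilde P)\<^sup>2"
    using a Gtilde_nonneg by (simp add: power2_sum)
  finally show ?thesis
    by (simp add: algebra_simps)
qed

text \<open>The two errors are dominated by the two components of the vector whose norm is the root
  of the potential: \<open>\<beta>\<close> overestimates the objective and \<open>z\<close>
  reproduces the residual.\<close>

lemma fw_output_errors:
  assumes inv: "fw_inv st" and dv: "dv \<le> dstar"
  shows "avg_obj P (fst st) \<le> dstar + sqrt (fw_potential dv st)"
    and "vnorm_plus m (avg_residual P (fst st)) \<le> sqrt (fw_potential dv st)"
proof -
  obtain x \<beta> z where st: "st = (x, \<beta>, z)"
    by (cases st)
  have "(1 / real N) * hval P i (x i) \<le> \<beta> i" if "i < N" for i
    using inv that N_pos by (auto simp: st fw_inv_def field_simps)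
  then have "avg_obj P x \<le> (\<Sum>i<N. \<beta> i)"
    unfolding avg_obj_def sum_distrib_left by (intro sum_mono) auto
  also have "\<dots> \<le> dv + fw_gamma dv st"
    by (simp add: st fw_gamma_def)
  also have "fw_gamma dv st \<le> sqrt (fw_potential dv st)"
    unfolding fw_potential_def by (intro real_le_rsqrt) (simp add: sum_nonneg)
  finally show "avg_obj P (fst st) \<le> dstar + sqrt (fw_potential dv st)"
    using dv by (simp add: st)
  have "z i j = (1 / real N) * Ax P i (x i) j" if "i < N" for i j
    using inv that N_pos by (auto simp: st fw_inv_def field_simps)
  then have "fw_dir st j = max (avg_residual P x j) 0" for j
    by (simp add: st fw_dir_def pos_part_def avg_residual_def sum_distrib_left)
  then show "vnorm_plus m (avg_residual P (fst st)) \<le> sqrt (fw_potential dv st)"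
    by (simp add: st fw_potential_def vnorm_plus_def)
qed

text \<open>Stage 1 controls only the first moment of the dual gap, whereas \<open>fw_rate\<close>
  contains its square. Taking the root for a fixed \<open>dv\<close>, before averaging over stage 1,
  makes the bound linear in the gap and turns the exponent 3 into 3/2.\<close>

lemma stage2_error:
  assumes x0: "\<And>i. i < N \<Longrightarrow> x0 i \<in> Xset P i" and dv: "dv \<le> dstar" and K: "K > 0"
  shows "measure_pmf.expectation (unif_indices N K) (\<lambda>r. sqrt (fw_potential dv (fw_iter P orc dv x0 r K)))
    \<le> (2 * real N / (real K + 2 * real N)) powr (3/2) * (2 * Hsup P + Gtilde P)
      + 3 * (dstar - dv) + 2 * Dconst P / sqrt (real K)"
proof -
  let ?E = "measure_pmf.expectation (unif_indices N K)"
  let ?\<phi> = "\<lambda>r. fw_potential dv (fw_iter P orc dv x0 r K)"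
  let ?a = "2 * Hsup P + Gtilde P + (dstar - dv)"
  define q where "q = 2 * real N / (real K + 2 * real N)"
  have q: "0 < q" "q \<le> 1"
    using N_pos by (auto simp: q_def)
  define u where "u = q powr (3/2) * ?a"
  define v where "v = 2 * (dstar - dv)"
  define w where "w = 2 * Dconst P / sqrt (real K)"
  have u: "u \<ge> 0"
    using Hsup_nonneg Gtilde_nonneg dv by (simp add: u_def)
  have v: "v \<ge> 0"
    using dv by (simp add: v_def)
  have w: "w \<ge> 0"
    by (simp add: w_def Dconst_def sum_nonneg)
  have "(q powr (3/2))\<^sup>2 = q ^ 3"
    using q by (simp add: power2_eq_square powr_add[symmetric] powr_numeral)
  then have "q ^ 3 * fw_potential dv (fw_init P x0) \<le> u\<^sup>2"
    using q fw_potential_init_le[OF x0 dv] by (simp add: u_def power_mult_distrib)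
  moreover have "2 * (dstar - dv)\<^sup>2 \<le> v\<^sup>2"
    unfolding v_def power_mult_distrib by simp
  moreover have "4 * (Dconst P)\<^sup>2 / (real K + 2 * real N) \<le> w\<^sup>2"
    using K by (simp add: w_def power_mult_distrib power_divide frac_le)
  ultimately have "?E ?\<phi> \<le> u\<^sup>2 + v\<^sup>2 + w\<^sup>2"
    using fw_rate[OF x0 dv, of K] by (simp add: q_def)
  also have "\<dots> \<le> (u + v + w)\<^sup>2"
    using u v w by (simp add: power2_sum)
  finally have "sqrt (?E ?\<phi>) \<le> u + v + w"
    using u v w by (intro real_le_lsqrt) auto
  moreover have "?E (\<lambda>r. sqrt (?\<phi> r)) \<le> sqrt (?E ?\<phi>)"
    using expectation_le_sqrt[of "unif_indices N K" "\<lambda>r. sqrt (?\<phi> r)"] N_pos fw_potential_nonneg by simp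
  \<comment> \<open>The gap inside the initial bound is moved to the linear term; with
    \<open>v\<close> this makes the factor 3.\<close>
  moreover have "u \<le> q powr (3/2) * (2 * Hsup P + Gtilde P) + (dstar - dv)"
  proof -
    have "q powr (3/2) \<le> 1"
      using q by (intro powr_le1) auto
    then have "q powr (3/2) * (dstar - dv) \<le> 1 * (dstar - dv)"
      using dv by (intro mult_right_mono) auto
    then show ?thesis
      by (simp add: u_def distrib_left)
  qed
  ultimately show ?thesis
    by (simp add: q_def v_def w_def)
qed

section \<open>Combining the stages, choosing \<open>T\<close> and counting oracle calls\<close>

lemma two_stage_accurate:
  assumes T: "T > 0" and \<Lambda>: "\<Lambda> > 0"
    and err: "(2 * real N / (real T + 2 * real N)) powr (3/2) * (2 * Hsup P + Gtilde P)
      + (3 * (Gtilde P * ((vnorm m lstar)\<^sup>2 / \<Lambda> + \<Lambda>) / 2) + 2 * Dconst P) / sqrt (real T) \<le> \<epsilon>"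
  shows "accurate_in_expectation P dstar \<epsilon> (run_pmf N T T) (two_stage_output P orc \<Lambda> T T)"
proof -
  define \<alpha> where "\<alpha> = \<Lambda> / (Gtilde P * sqrt (real T))"
  define dv where "dv = (\<lambda>s. dual_fun P (dual_avg P orc \<alpha> T s))"
  define st where "st = (\<lambda>(s, r). fw_iter P orc (dv s) (primal_avg P orc \<alpha> T s) r T)"
  define err where "err = (\<lambda>(s, r). sqrt (fw_potential (dv s) (st (s, r))))"
  let ?R = "run_pmf N T T"
  let ?E1 = "measure_pmf.expectation (unif_indices N (T - 1))"
  let ?E2 = "measure_pmf.expectation (unif_indices N T)"
  let ?q = "(2 * real N / (real T + 2 * real N)) powr (3/2) * (2 * Hsup P + Gtilde P)"
  have fin: "finite (set_pmf ?R)"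
    using N_pos by (simp add: run_pmf_def)
  note int = integrable_measure_pmf_finite[OF fin]
  have out: "two_stage_output P orc \<Lambda> T T \<omega> = fst (st \<omega>)" for \<omega>
    by (cases \<omega>) (simp add: two_stage_output_def st_def dv_def \<alpha>_def Let_def)
  have inv: "fw_inv (st \<omega>)" for \<omega>
    by (cases \<omega>) (auto simp: st_def intro!: fw_inv_iter primal_avg_in)
  have dv: "dv s \<le> dstar" for s
    unfolding dv_def by (intro dual_fun_le_dstar dual_avg_nonneg)
  have obj: "avg_obj P (fst (st \<omega>)) \<le> dstar + err \<omega>"
    and res: "vnorm_plus m (avg_residual P (fst (st \<omega>))) \<le> err \<omega>" for \<omega>
    using fw_output_errors[OF inv dv, of \<omega> "fst \<omega>"] by (auto simp: err_def split: prod.split)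
  \<comment> \<open>Stage 2 is bounded with the stage 1 indices \<open>s\<close> fixed, which fixes
    the dual value and the starting point; averaging over \<open>s\<close> then brings in the
    expected dual gap.\<close>
  have "measure_pmf.expectation ?R err = ?E1 (\<lambda>s. ?E2 (\<lambda>r. err (s, r)))"
    unfolding run_pmf_def using N_pos by (intro expectation_pair_pmf_finite) auto
  also have "\<dots> \<le> ?E1 (\<lambda>s. ?q + 3 * (dstar - dv s) + 2 * Dconst P / sqrt (real T))"
  proof (intro integral_mono integrable_unif_indices N_pos)
    fix s
    show "?E2 (\<lambda>r. err (s, r)) \<le> ?q + 3 * (dstar - dv s) + 2 * Dconst P / sqrt (real T)"
      unfolding err_def st_def prod.case
      by (rule stage2_error[OF primal_avg_in dv T])
  qed
  also have "\<dots> = ?q + 3 * ?E1 (\<lambda>s. dstar - dv s) + 2 * Dconst P / sqrt (real T)"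
    using N_pos by simp
  also have "\<dots> \<le> ?q + 3 * (Gtilde P * ((vnorm m lstar)\<^sup>2 / \<Lambda> + \<Lambda>) / (2 * sqrt (real T))) + 2 * Dconst P / sqrt (real T)"
    using dual_avg_gap[OF T \<Lambda>] unfolding dv_def \<alpha>_def by (intro add_right_mono add_left_mono mult_left_mono) auto
  also have "\<dots> \<le> \<epsilon>"
    using assms(3) by (simp add: add_divide_distrib)
  finally have E: "measure_pmf.expectation ?R err \<le> \<epsilon>" .
  have "measure_pmf.expectation ?R (\<lambda>\<omega>. avg_obj P (fst (st \<omega>))) \<le> measure_pmf.expectation ?R (\<lambda>\<omega>. dstar + err \<omega>)"
    by (intro integral_mono int obj)
  also have "\<dots> = dstar + measure_pmf.expectation ?R err"
    by (subst Bochner_Integration.integral_add) (simp_all add: fin integrable_measure_pmf_finite)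
  finally have 1: "measure_pmf.expectation ?R (\<lambda>\<omega>. avg_obj P (fst (st \<omega>))) \<le> dstar + \<epsilon>"
    using E by linarith
  have "measure_pmf.expectation ?R (\<lambda>\<omega>. vnorm_plus m (avg_residual P (fst (st \<omega>)))) \<le> measure_pmf.expectation ?R err"
    by (intro integral_mono int res)
  then have 2: "measure_pmf.expectation ?R (\<lambda>\<omega>. vnorm_plus m (avg_residual P (fst (st \<omega>)))) \<le> \<epsilon>"
    using E by linarith
  have "fst (st \<omega>) i \<in> Xset P i" if "i < N" for \<omega> i
    using inv[of \<omega>] that by (auto simp: fw_inv_def split: prod.splits)
  with 1 2 show ?thesis
    unfolding accurate_in_expectation_def out by blast
qed

end

theorem theorem3p4:
  fixes G H D \<Lambda> L \<epsilon>\<^sub>0 :: real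
  assumes "\<Lambda> > 0" and "\<epsilon>\<^sub>0 > 0"
  shows "\<exists>C>0. \<forall>(P :: sep_problem) (orc :: oracle_fun) (lstar :: vect) (\<epsilon> :: real).
    sep_convex_problem P \<longrightarrow> is_oracle P orc \<longrightarrow>
    dual_maximizer P lstar \<longrightarrow> ereal (dual_fun P lstar) = primal_value P \<longrightarrow>
    bdd_above (Hvals P) \<longrightarrow>
    Gtilde P = G \<longrightarrow> Hsup P = H \<longrightarrow> Dconst P = D \<longrightarrow> vnorm (ncons P) lstar = L \<longrightarrow>
    0 < \<epsilon> \<longrightarrow> \<epsilon> \<le> \<epsilon>\<^sub>0 \<longrightarrow>
    (\<exists>T\<^sub>0\<ge>1.
      (\<forall>T\<ge>T\<^sub>0. accurate_in_expectation P (dual_fun P lstar) \<epsilon>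
         (run_pmf (nblocks P) T T) (two_stage_output P orc \<Lambda> T T)) \<and>
      real (oracle_calls (nblocks P) T\<^sub>0 T\<^sub>0)
        \<le> C * (1 / \<epsilon>\<^sup>2 + real (nblocks P) / \<epsilon> powr (2 / 3)))"
proof -
  \<comment> \<open>The constants are fixed before any problem is given, so their signs are unknown;
    absolute value plus 1 makes \<open>a\<close> and \<open>B\<close> positive upper bounds.\<close>
  define a where "a = \<bar>2 * H + G\<bar> + 1"
  define B where "B = \<bar>3 * (G * (L\<^sup>2 / \<Lambda> + \<Lambda>) / 2) + 2 * D\<bar> + 1"
  have a: "a > 0" and B: "B > 0"
    by (simp_all add: a_def B_def)
  \<comment> \<open>The first two summands pay for the iterations of both stages. As \<epsilon> is
    at most \<open>\<epsilon>\<^sub>0\<close>, the third absorbs the additive constant from rounding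
    and the fourth the \<open>N\<close> calls of the last iteration of stage 1.\<close>
  define C where "C = 4 * (2 * a) powr (2/3) + 8 * B\<^sup>2 + 2 * \<epsilon>\<^sub>0\<^sup>2 + \<epsilon>\<^sub>0 powr (2/3)"
  have "C > 0"
    using B assms by (simp add: C_def add_nonneg_pos)
  moreover have "\<exists>T\<^sub>0\<ge>1.
      (\<forall>T\<ge>T\<^sub>0. accurate_in_expectation P (dual_fun P lstar) \<epsilon>
         (run_pmf (nblocks P) T T) (two_stage_output P orc \<Lambda> T T)) \<and>
      real (oracle_calls (nblocks P) T\<^sub>0 T\<^sub>0)
        \<le> C * (1 / \<epsilon>\<^sup>2 + real (nblocks P) / \<epsilon> powr (2 / 3))"
    if P: "sep_convex_problem P" "is_oracle P orc" "dual_maximizer P lstar"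
      "ereal (dual_fun P lstar) = primal_value P" "bdd_above (Hvals P)"
      and const: "Gtilde P = G" "Hsup P = H" "Dconst P = D" "vnorm (ncons P) lstar = L"
      and \<epsilon>: "0 < \<epsilon>" "\<epsilon> \<le> \<epsilon>\<^sub>0" for P orc lstar \<epsilon>
  proof -
    interpret strongly_dual_problem P orc lstar
      by unfold_locales (use P in auto)
    \<comment> \<open>\<open>T\<close> beyond \<open>?X\<close> brings the contraction term below
      \<epsilon>/2, the exponent 2/3 undoing the 3/2; \<open>T\<close> beyond \<open>?Y\<close> does
      so for the terms of order one over the root of \<open>T\<close>.\<close>
    let ?X = "2 * real N * (2 * a / \<epsilon>) powr (2/3)"
    let ?Y = "(2 * B / \<epsilon>)\<^sup>2"
    define T0 where "T0 = nat \<lceil>?X + ?Y\<rceil>"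
    have X: "?X > 0" and Y: "?Y > 0"
      using N_pos a B \<epsilon> by simp_all
    have T0: "?X + ?Y \<le> real T0" "real T0 \<le> ?X + ?Y + 1"
      using X Y unfolding T0_def by linarith+
    have acc: "accurate_in_expectation P (dual_fun P lstar) \<epsilon> (run_pmf N T T) (two_stage_output P orc \<Lambda> T T)"
      if "T \<ge> T0" for T
    proof (rule two_stage_accurate[OF _ assms(1)])
      have XT: "?X \<le> real T" and YT: "?Y \<le> real T"
        using that T0 X Y by linarith+
      show T: "T > 0"
        using XT X by linarith
      let ?q = "2 * real N / (real T + 2 * real N)"
      have "?q \<le> 2 * real N / real T"
        using T N_pos by (intro divide_left_mono) auto
      also have "\<dots> \<le> 2 * real N / ?X"
        using XT X N_pos by (intro divide_left_mono) auto
      also have "\<dots> = (\<epsilon> / (2 * a)) powr (2/3)"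
        using N_pos a \<epsilon> by (simp add: powr_divide)
      finally have "?q powr (3/2) \<le> ((\<epsilon> / (2 * a)) powr (2/3)) powr (3/2)"
        by (intro powr_mono2) auto
      also have "\<dots> = \<epsilon> / (2 * a)"
        using a \<epsilon> by (simp add: powr_powr)
      finally have "?q powr (3/2) * (2 * H + G) \<le> \<epsilon> / (2 * a) * a"
        using Hsup_nonneg Gtilde_nonneg const \<epsilon> a by (intro mult_mono) (auto simp: a_def)
      also have "\<dots> = \<epsilon> / 2"
        using a by simp
      finally have 1: "?q powr (3/2) * (2 * H + G) \<le> \<epsilon> / 2" .
      have "2 * B / \<epsilon> \<le> sqrt (real T)"
        using YT by (rule real_le_rsqrt)
      then have "B / sqrt (real T) \<le> \<epsilon> / 2"
        using T \<epsilon> by (simp add: field_simps)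
      moreover have "(3 * (G * (L\<^sup>2 / \<Lambda> + \<Lambda>) / 2) + 2 * D) / sqrt (real T) \<le> B / sqrt (real T)"
        by (intro divide_right_mono) (auto simp: B_def)
      ultimately show "?q powr (3/2) * (2 * Hsup P + Gtilde P)
          + (3 * (Gtilde P * ((vnorm m lstar)\<^sup>2 / \<Lambda> + \<Lambda>) / 2) + 2 * Dconst P) / sqrt (real T) \<le> \<epsilon>"
        unfolding const using 1 by linarith
    qed
    have ge1: "T0 \<ge> 1"
      using T0 X Y by linarith
    have calls: "real (oracle_calls N T0 T0) \<le> 2 * (?X + ?Y) + 2 + real N"
      using T0 ge1 by (simp add: oracle_calls_def)
    let ?u = "1 / \<epsilon>\<^sup>2"
    let ?v = "real N / \<epsilon> powr (2/3)"
    have "2 * ?X = 4 * (2 * a) powr (2/3) * ?v"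
      using a \<epsilon> by (simp add: powr_divide)
    moreover have "2 * ?Y = 8 * B\<^sup>2 * ?u"
      by (simp add: power_divide power_mult_distrib)
    moreover have "2 \<le> 2 * \<epsilon>\<^sub>0\<^sup>2 * ?u"
      using \<epsilon> by (simp add: field_simps power_mono)
    moreover have "real N \<le> \<epsilon>\<^sub>0 powr (2/3) * ?v"
    proof -
      have "\<epsilon> powr (2/3) \<le> \<epsilon>\<^sub>0 powr (2/3)"
        using \<epsilon> by (intro powr_mono2) auto
      from mult_right_mono[OF this, of "real N"] show ?thesis
        using \<epsilon> by (simp add: field_simps)
    qed
    ultimately have "2 * (?X + ?Y) + 2 + real N
        \<le> (4 * (2 * a) powr (2/3) + \<epsilon>\<^sub>0 powr (2/3)) * ?v + (8 * B\<^sup>2 + 2 * \<epsilon>\<^sub>0\<^sup>2) * ?u"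
      unfolding distrib_left distrib_right by linarith
    also have "\<dots> \<le> C * ?v + C * ?u"
      using \<epsilon> by (intro add_mono mult_right_mono) (auto simp: C_def)
    finally show ?thesis
      using acc ge1 calls by (intro exI[of _ T0]) (auto simp: distrib_left)
  qed
  ultimately show ?thesis
    by (intro exI[of _ C]) blast
qed

end
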